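(* Let $\mathcal{V}$ be a non-degenerate Venn diagram. Then the problem $\#\textsc{HyperMotif}(\mathcal{V})$ is not solvable in FPT-near-linear time (and thus also not in near-linear time) unless either the Triangle Hypothesis or the Hyperclique Hypothesis fails.
   Context: A hypergraph $G$ is a pair of a finite vertex set $V(G)$ and a set $E(G)$ of edges, each a non-empty subset of $V(G)$; every vertex lies in at least one edge. For $A\subseteq E(G)$, $G[A]$ is the hypergraph with edge set $A$ and vertex set $\bigcup_{e\in A}e$. $\mathsf{rank}(G)$ is the maximum cardinality of an edge of $G$. $|G|$ is the size of (the encoding of) $G$, and $\tilde O$ hides polylogarithmic factors. A Venn diagram is a vector $\mathcal{V}=(\mathcal{V}_J)_{\emptyset\ne J\subseteq\{1,2,3\}}\in\{0,1\}^7$. A hypergraph $G$ with exactly three edges satisfies $\mathcal{V}$, written $\mathcal{V}(G)=1$, if there is an ordering $e_1,e_2,e_3$ of $E(G)$ such that for all non-empty $J\subseteq\{1,2,3\}$: $\mathcal{V}_J=1 \Leftrightarrow \left(\bigcap_{i\in J}e_i\right)\setminus\left(\bigcup_{i\in\{1,2,3\}\setminus J}e_i\right)\neq\emptyset$. Standing convention: only Venn diagrams that correspond to connected motifs with three pairwise distinct edges are considered, one per equivalence class under permutation of the three sets (26 in total). $\mathcal{V}$ is degenerate if every hypergraph $G$ with $\mathcal{V}(G)=1$ has two (distinct) edges $e,e'$ with $e\subseteq e'$. Writing $\mathcal V$ as the list of those $J$ with $\mathcal V_J=1$ (with $12$ short for $\{1,2\}$ etc.), the non-degenerate Venn diagrams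 are exactly: $\mathcal V_1=\{1,2,3,12,13,23\}$, $\mathcal V_2=\{1,3,12,13,23\}$, $\mathcal V_3=\{3,12,13,23\}$, $\mathcal V_4=\{12,13,23\}$, $\mathcal V_5=\{1,2,3,12,23\}$, $\mathcal V_6=\{1,3,12,23\}$, $\mathcal V_7=\{1,2,3,12,13,23,123\}$, $\mathcal V_8=\{1,3,12,13,23,123\}$, $\mathcal V_9=\{3,12,13,23,123\}$, $\mathcal V_{10}=\{12,13,23,123\}$, $\mathcal V_{11}=\{1,3,12,23,123\}$, $\mathcal V_{12}=\{1,2,3,12,123\}$, $\mathcal V_{13}=\{1,2,3,123\}$, $\mathcal V_{14}=\{1,2,3,12,23,123\}$. $\mathcal{M}(\mathcal{V}\to G):=\{A\subseteq E(G)\mid \#A=3 \wedge \mathcal{V}(G[A])=1\}$. The problem $\#\textsc{HyperMotif}(\mathcal{V})$ ($\mathcal V$ fixed) is: given a hypergraph $G$, compute $\#\mathcal{M}(\mathcal{V}\to G)$; the parameter is $\mathsf{rank}(G)$. It is solvable in FPT-near-linear time if there is a computable $f$ and an algorithm solving it in time $f(\mathsf{rank}(G))\cdot\tilde O(|G|)$; in near-linear time if it is solvable in time $\tilde O(|G|)$. Triangle Hypothesis: there is no algorithm that, given a graph with $m$ edges, decides in time $\tilde O(m)$ whether it contains a triangle. Hyperclique Hypothesis: for no pair of integers $k>h>2$ is there an $\varepsilon>0$ and an algorithm that, given an $h$-uniform hypergraph $H$ with $n$ vertices, decides in time $\tilde O(n^{k-\varepsilon})$ whether $H$ contains a hyperclique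 of size $k$, i.e. a $k$-element vertex set all of whose $h$-element subsets are edges of $H$. *)

theory Defs
  imports
    Complex_Main
    "HOL-Library.Landau_Symbols"
    "HOL-Library.Discrete_Functions"
begin

section \<open>Hypergraphs\<close>

record 'v hypergraph =
  verts :: "'v set"
  edges :: "'v set set"

definition hypergraph :: "'v hypergraph \<Rightarrow> bool" where
  "hypergraph G \<longleftrightarrow>
     finite (verts G) \<and>
     (\<forall>e\<in>edges G. e \<noteq> {} \<and> e \<subseteq> verts G) \<and>
     (\<forall>v\<in>verts G. \<exists>e\<in>edges G. v \<in> e)"

text \<open>The hypergraph without edges gets rank 0.\<close>

definition hypergraph_rank :: "'v hypergraph \<Rightarrow> nat" where
  "hypergraph_rank G = Max (insert 0 (card ` edges G))"

definition edge_induced :: "'v hypergraph \<Rightarrow> 'v set set \<Rightarrow> 'v hypergraph" where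
  "edge_induced G A = \<lparr>verts = \<Union>A, edges = A\<rparr>"

definition hypergraph_connected :: "'v hypergraph \<Rightarrow> bool" where
  "hypergraph_connected G \<longleftrightarrow>
     (\<forall>u\<in>verts G. \<forall>v\<in>verts G. (u, v) \<in> {(x, y). \<exists>e\<in>edges G. x \<in> e \<and> y \<in> e}\<^sup>*)"

definition uniform :: "nat \<Rightarrow> 'v hypergraph \<Rightarrow> bool" where
  "uniform h G \<longleftrightarrow> (\<forall>e\<in>edges G. card e = h)"

definition has_hyperclique :: "nat \<Rightarrow> nat \<Rightarrow> 'v hypergraph \<Rightarrow> bool" where
  "has_hyperclique h k H \<longleftrightarrow>
     (\<exists>K\<subseteq>verts H. card K = k \<and> (\<forall>S\<subseteq>K. card S = h \<longrightarrow> S \<in> edges H))"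

text \<open>A graph is a 2-uniform hypergraph.\<close>

definition has_triangle :: "'v hypergraph \<Rightarrow> bool" where
  "has_triangle G \<longleftrightarrow>
     (\<exists>x y z. x \<noteq> y \<and> y \<noteq> z \<and> x \<noteq> z \<and>
        {x, y} \<in> edges G \<and> {y, z} \<in> edges G \<and> {x, z} \<in> edges G)"


section \<open>Venn diagrams and motifs\<close>

text \<open>Only the seven entries at non-empty \<open>J \<subseteq> {1,2,3}\<close> carry information; every notion below
  ignores the other values.\<close>

type_synonym venn = "nat set \<Rightarrow> bool"

text \<open>The bijection \<open>e\<close> is the ordering \<open>e\<^sub>1, e\<^sub>2, e\<^sub>3\<close>; it forces \<open>G\<close> to have exactly
  three edges.\<close>

definition satisfies_venn :: "venn \<Rightarrow> 'v hypergraph \<Rightarrow> bool" where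
  "satisfies_venn V G \<longleftrightarrow>
     (\<exists>e :: nat \<Rightarrow> 'v set. bij_betw e {1, 2, 3} (edges G) \<and>
        (\<forall>J. J \<noteq> {} \<and> J \<subseteq> {1, 2, 3} \<longrightarrow>
           (V J \<longleftrightarrow> (\<Inter>i\<in>J. e i) - (\<Union>i\<in>{1, 2, 3} - J. e i) \<noteq> {})))"

text \<open>The standing convention on Venn diagrams. In the following two definitions, hypergraphs on
  natural numbers suffice, since every finite hypergraph is isomorphic to one of these.\<close>

definition connected_venn :: "venn \<Rightarrow> bool" where
  "connected_venn V \<longleftrightarrow>
     (\<exists>G :: nat hypergraph. hypergraph G \<and> hypergraph_connected G \<and> satisfies_venn V G)"

definition degenerate :: "venn \<Rightarrow> bool" where
  "degenerate V \<longleftrightarrow>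
     (\<forall>G :: nat hypergraph. hypergraph G \<and> satisfies_venn V G \<longrightarrow>
        (\<exists>e\<in>edges G. \<exists>e'\<in>edges G. e \<noteq> e' \<and> e \<subseteq> e'))"

definition motifs :: "venn \<Rightarrow> 'v hypergraph \<Rightarrow> 'v set set set" where
  "motifs V G = {A. A \<subseteq> edges G \<and> card A = 3 \<and> satisfies_venn V (edge_induced G A)}"


section \<open>Machine model\<close>

text \<open>
  Algorithms are programs of a deterministic random access machine under the logarithmic cost
  criterion, written in a structured language. There are registers and several
  zero-initialised memory banks, all cells holding natural numbers. Register and bank names are
  constants of the program, so each program uses only finitely many of them; addresses within a bank
  are computed. Every step costs the binary length of the operands and addresses it touches;
  running times agree with those on a word RAM with logarithmic word length up to polylogarithmic
  factors, so that near-linear time has its usual meaning.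
\<close>

datatype arith = Add | Sub | Mul | Div

fun arith_val :: "arith \<Rightarrow> nat \<Rightarrow> nat \<Rightarrow> nat" where
  "arith_val Add x y = x + y"
| "arith_val Sub x y = x - y"
| "arith_val Mul x y = x * y"
| "arith_val Div x y = x div y"

datatype com =
    Skip
  | Const nat nat            \<comment> \<open>\<open>Const r n\<close>: register \<open>r := n\<close>\<close>
  | Arith arith nat nat nat  \<comment> \<open>\<open>Arith f r a b\<close>: register \<open>r := a f b\<close>, for registers \<open>a\<close>, \<open>b\<close>\<close>
  | Load nat nat nat         \<comment> \<open>\<open>Load r b a\<close>: register \<open>r :=\<close> cell of bank \<open>b\<close> addressed by register \<open>a\<close>\<close>
  | Store nat nat nat        \<comment> \<open>\<open>Store b a r\<close>: cell of bank \<open>b\<close> addressed by register \<open>a :=\<close> register \<open>r\<close>\<close>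
  | Seq com com
  | If nat com com           \<comment> \<open>first branch iff the register is non-zero\<close>
  | While nat com            \<comment> \<open>loop as long as the register is non-zero\<close>

type_synonym state = "(nat \<Rightarrow> nat) \<times> (nat \<Rightarrow> nat \<Rightarrow> nat)"

text \<open>Number of binary digits; the length of 0 is 1.\<close>

definition bits :: "nat \<Rightarrow> nat" where
  "bits n = Suc (floor_log n)"

text \<open>\<open>exec P s c s'\<close>: started in \<open>s\<close>, the program \<open>P\<close> halts in \<open>s'\<close> at total cost \<open>c\<close>.\<close>

inductive exec :: "com \<Rightarrow> state \<Rightarrow> nat \<Rightarrow> state \<Rightarrow> bool" where
  Skip: "exec Skip s 1 s"
| Const: "exec (Const r n) (R, M) (bits n) (R(r := n), M)"
| Arith: "exec (Arith f r a b) (R, M) (bits (R a) + bits (R b))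
            (R(r := arith_val f (R a) (R b)), M)"
| Load: "exec (Load r b a) (R, M) (bits (R a) + bits (M b (R a))) (R(r := M b (R a)), M)"
| Store: "exec (Store b a r) (R, M) (bits (R a) + bits (R r))
            (R, M(b := (M b)(R a := R r)))"
| Seq: "exec P s c s' \<Longrightarrow> exec Q s' d s'' \<Longrightarrow> exec (Seq P Q) s (c + d) s''"
| IfTrue: "fst s r \<noteq> 0 \<Longrightarrow> exec P s c s' \<Longrightarrow> exec (If r P Q) s (bits (fst s r) + c) s'"
| IfFalse: "fst s r = 0 \<Longrightarrow> exec Q s c s' \<Longrightarrow> exec (If r P Q) s (bits (fst s r) + c) s'"
| WhileTrue: "fst s r \<noteq> 0 \<Longrightarrow> exec P s c s' \<Longrightarrow> exec (While r P) s' d s'' \<Longrightarrow>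
    exec (While r P) s (bits (fst s r) + c + d) s''"
| WhileFalse: "fst s r = 0 \<Longrightarrow> exec (While r P) s (bits (fst s r)) s"

inductive_cases exec_SkipE: "exec Skip s c t"
inductive_cases exec_ConstE: "exec (Const r n) s c t"
inductive_cases exec_ArithE: "exec (Arith f r a b) s c t"
inductive_cases exec_LoadE: "exec (Load r b a) s c t"
inductive_cases exec_StoreE: "exec (Store b a r) s c t"
inductive_cases exec_SeqE: "exec (Seq P Q) s c t"
inductive_cases exec_IfE: "exec (If r P Q) s c t"
inductive_cases exec_WhileE: "exec (While r P) s c t"

lemma exec_deterministic:
  "exec P s c t \<Longrightarrow> exec P s c' t' \<Longrightarrow> c' = c \<and> t' = t"
proof (induction arbitrary: c' t' rule: exec.induct)
  case Skip
  then show ?case by (elim exec_SkipE) simp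
next
  case Const
  then show ?case by (elim exec_ConstE) simp
next
  case Arith
  then show ?case by (elim exec_ArithE) simp
next
  case Load
  then show ?case by (elim exec_LoadE) simp
next
  case Store
  then show ?case by (elim exec_StoreE) simp
next
  case (Seq P s c s' Q d s'')
  from Seq.prems obtain c1 d1 s1 where "c' = c1 + d1" "exec P s c1 s1" "exec Q s1 d1 t'"
    by (elim exec_SeqE)
  then show ?case using Seq.IH(1)[of c1 s1] Seq.IH(2)[of d1 t'] by auto
next
  case (IfTrue s r P c s' Q)
  from IfTrue.prems show ?case by (elim exec_IfE) (use IfTrue.hyps in \<open>auto dest: IfTrue.IH\<close>)
next
  case (IfFalse s r Q c s' P)
  from IfFalse.prems show ?case by (elim exec_IfE) (use IfFalse.hyps in \<open>auto dest: IfFalse.IH\<close>)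
next
  case (WhileTrue s r P c s' d s'')
  from WhileTrue.prems obtain c1 d1 s1
    where "c' = bits (fst s r) + c1 + d1" "exec P s c1 s1" "exec (While r P) s1 d1 t'"
    by (rule exec_WhileE) (use WhileTrue.hyps in auto)
  then show ?case using WhileTrue.IH(1)[of c1 s1] WhileTrue.IH(2)[of d1 t'] by auto
next
  case WhileFalse
  from WhileFalse.prems show ?case by (rule exec_WhileE) (use WhileFalse.hyps in auto)
qed

text \<open>The input words are at addresses 0, 1, \<open>\<dots>\<close> of bank 0; the output is register 0.\<close>

definition initial :: "nat list \<Rightarrow> state" where
  "initial xs = (\<lambda>_. 0, \<lambda>b a. if b = 0 \<and> a < length xs then xs ! a else 0)"

definition outputs :: "com \<Rightarrow> nat list \<Rightarrow> nat \<Rightarrow> nat \<Rightarrow> bool" where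
  "outputs P xs y c \<longleftrightarrow> (\<exists>s. exec P (initial xs) c s \<and> fst s 0 = y)"

definition computable :: "(nat \<Rightarrow> nat) \<Rightarrow> bool" where
  "computable f \<longleftrightarrow> (\<exists>P. \<forall>n. \<exists>c. outputs P [n] (f n) c)"


section \<open>Problems on hypergraphs\<close>

text \<open>Instances have vertex set \<open>{0,\<dots>,n-1}\<close>, so that vertex names are short.\<close>

definition instances :: "nat hypergraph set" where
  "instances = {G. hypergraph G \<and> verts G = {..<card (verts G)}}"

text \<open>The number of vertices, the number of edges, and for each edge its cardinality followed by its
  vertices. The order of the edges, and of the vertices within an edge, is arbitrary.\<close>

definition encodes :: "nat list \<Rightarrow> nat hypergraph \<Rightarrow> bool" where
  "encodes xs G \<longleftrightarrow>
     (\<exists>es. distinct (map set es) \<and> (\<forall>e\<in>set es. distinct e) \<and> set (map set es) = edges G \<and>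
        xs = card (verts G) # length es # concat (map (\<lambda>e. length e # e) es))"

text \<open>\<open>|G|\<close>, the bit length of any encoding of \<open>G\<close>.\<close>

definition hypergraph_size :: "nat hypergraph \<Rightarrow> nat" where
  "hypergraph_size G =
     bits (card (verts G)) + bits (card (edges G)) +
     (\<Sum>e\<in>edges G. bits (card e) + (\<Sum>v\<in>e. bits v))"

lemma hypergraph_size_encoding:
  assumes "encodes xs G"
  shows "hypergraph_size G = sum_list (map bits xs)"
proof -
  obtain es where es: "distinct (map set es)" "\<forall>e\<in>set es. distinct e"
    "set (map set es) = edges G"
    "xs = card (verts G) # length es # concat (map (\<lambda>e. length e # e) es)"
    using assms unfolding encodes_def by blast
  have dist: "distinct es" and inj: "inj_on set (set es)"
    using es(1) by (simp_all add: distinct_map)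
  have edges: "edges G = set ` set es"
    using es(3) by simp
  have "(\<Sum>e\<in>edges G. bits (card e) + (\<Sum>v\<in>e. bits v)) =
      (\<Sum>e\<in>set es. bits (card (set e)) + (\<Sum>v\<in>set e. bits v))"
    unfolding edges by (subst sum.reindex[OF inj]) (simp only: comp_def)
  also have "\<dots> = (\<Sum>e\<in>set es. bits (length e) + sum_list (map bits e))"
  proof (rule sum.cong[OF refl])
    fix e assume "e \<in> set es"
    then have "distinct e" using es(2) by blast
    then show "bits (card (set e)) + (\<Sum>v\<in>set e. bits v) = bits (length e) + sum_list (map bits e)"
      by (simp only: distinct_card sum_list_distinct_conv_sum_set)
  qed
  also have "\<dots> = sum_list (map (\<lambda>e. bits (length e) + sum_list (map bits e)) es)"
    by (simp only: sum_list_distinct_conv_sum_set[OF dist])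
  also have "\<dots> = sum_list (map bits (concat (map (\<lambda>e. length e # e) es)))"
    by (induction es) simp_all
  finally have "(\<Sum>e\<in>edges G. bits (card e) + (\<Sum>v\<in>e. bits v)) = \<dots>" .
  moreover have "card (edges G) = length es"
    unfolding edges by (simp only: card_image[OF inj] distinct_card[OF dist])
  ultimately show ?thesis
    unfolding hypergraph_size_def es(4) by simp
qed

definition solves_within ::
  "com \<Rightarrow> nat hypergraph set \<Rightarrow> (nat hypergraph \<Rightarrow> nat) \<Rightarrow> (nat hypergraph \<Rightarrow> real) \<Rightarrow> bool" where
  "solves_within P I F T \<longleftrightarrow>
     (\<forall>G\<in>I. \<forall>xs. encodes xs G \<longrightarrow> (\<exists>c. outputs P xs (F G) c \<and> real c \<le> T G))"

text \<open>Decision problems are functions with values in \<open>{0, 1}\<close>.\<close>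

definition soft_O :: "(nat \<Rightarrow> real) \<Rightarrow> (nat \<Rightarrow> real) set" where
  "soft_O g = {t. \<exists>d :: nat. t \<in> O(\<lambda>n. g n * ln (real n) ^ d)}"

definition fpt_near_linear_time :: "venn \<Rightarrow> bool" where
  "fpt_near_linear_time V \<longleftrightarrow>
     (\<exists>f. computable f \<and> (\<exists>t\<in>soft_O real. \<exists>P.
        solves_within P instances (\<lambda>G. card (motifs V G))
          (\<lambda>G. real (f (hypergraph_rank G)) * t (hypergraph_size G))))"

definition near_linear_time :: "venn \<Rightarrow> bool" where
  "near_linear_time V \<longleftrightarrow>
     (\<exists>t\<in>soft_O real. \<exists>P.
        solves_within P instances (\<lambda>G. card (motifs V G)) (\<lambda>G. t (hypergraph_size G)))"

definition triangle_hypothesis :: bool where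
  "triangle_hypothesis \<longleftrightarrow>
     \<not> (\<exists>t\<in>soft_O real. \<exists>P.
          solves_within P {G \<in> instances. uniform 2 G} (\<lambda>G. of_bool (has_triangle G))
            (\<lambda>G. t (card (edges G))))"

definition hyperclique_hypothesis :: bool where
  "hyperclique_hypothesis \<longleftrightarrow>
     \<not> (\<exists>(k :: nat) (h :: nat) (\<epsilon> :: real). k > h \<and> h > 2 \<and> \<epsilon> > 0 \<and>
          (\<exists>t\<in>soft_O (\<lambda>n. real n powr (real k - \<epsilon>)). \<exists>P.
             solves_within P {H \<in> instances. uniform h H} (\<lambda>H. of_bool (has_hyperclique h k H))
               (\<lambda>H. t (card (verts H)))))"

end

theory Submission
  imports Defs
begin

text \<open>
  The Triangle Hypothesis alone suffices. Take the tripartite double covers of a graph: every vertex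
  \<open>u\<close> becomes \<open>(u, i, s)\<close> with a class \<open>i \<in> \<int>/3\<close> and a sheet \<open>s \<in> \<int>/2\<close>, and every arc \<open>(u, v)\<close>
  becomes the edges from \<open>(u, i, s)\<close> to \<open>(v, i + 1, s + \<sigma>[i = 2])\<close>, where \<open>\<sigma> = 0\<close> gives two disjoint
  copies and \<open>\<sigma> = 1\<close> a twisted cover in which triangles do not lift. The edges become hyperedges
  by adding one common vertex if \<open>V {1, 2, 3}\<close>, and a private vertex to each edge of class \<open>i\<close> if
  \<open>V {i + 1}\<close>.

  Three edges that do not project to a triangle with one edge per class cannot detect the twist: it is
  removed by a change of sheets, so they contribute equally to both motif counts. Above a triangle,
  the number of intersecting pairs is odd for \<open>\<sigma> = 0\<close> and even for \<open>\<sigma> = 1\<close>, so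
  motifs exist for only one of the two values of \<open>\<sigma>\<close>, and non-degeneracy of \<open>V\<close> ensures that they do
  exist. Hence the graph contains a triangle iff the two counts differ, and the covers have rank at most 4
  and near-linear size.
\<close>

section \<open>Venn diagrams\<close>

text \<open>The covers contain many motifs that have nothing to do with triangles. Comparing two
  counts removes them without ever counting them: it is enough that their number does not depend on
  \<sigma>. The twist is a cocycle with values in \<int>/2, placed on the passage from class 2 to
  class 0. It is a coboundary over any three arcs that do not close up around the three classes,
  whereas around a closed triple it is an invariant and amounts to a single parity condition on the
  three sheets. Up to that condition the sheets are free, so above a triangle one cover realizes
  every pattern of pairwise intersections of one parity, and the other cover every pattern of the
  other parity. This is why one construction serves every \<open>V\<close>. The triple region is
  governed by the common vertex, and a single region is filled by a private vertex. The only region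
  that could resist is a single one that has to be empty; non-degeneracy then makes both pairwise
  regions of that edge present, so that both of its core vertices are shared.\<close>

definition venn_ordering :: "venn \<Rightarrow> 'v set set \<Rightarrow> (nat \<Rightarrow> 'v set) \<Rightarrow> bool" where
  "venn_ordering V S e \<longleftrightarrow> bij_betw e {1, 2, 3} S \<and>
     (\<forall>J. J \<noteq> {} \<longrightarrow> J \<subseteq> {1, 2, 3} \<longrightarrow> (V J \<longleftrightarrow> (\<exists>x. \<forall>i\<in>{1, 2, 3}. x \<in> e i \<longleftrightarrow> i \<in> J)))"

lemma venn_orderingI:
  assumes "bij_betw e {1, 2, 3} S"
    and "\<And>J. J \<noteq> {} \<Longrightarrow> J \<subseteq> {1, 2, 3} \<Longrightarrow> V J \<longleftrightarrow> (\<exists>x. \<forall>i\<in>{1, 2, 3}. x \<in> e i \<longleftrightarrow> i \<in> J)"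
  shows "venn_ordering V S e"
  unfolding venn_ordering_def by (intro conjI allI impI assms)

lemma venn_orderingD:
  assumes "venn_ordering V S e"
  shows "bij_betw e {1, 2, 3} S"
    and "\<And>J. J \<noteq> {} \<Longrightarrow> J \<subseteq> {1, 2, 3} \<Longrightarrow> V J \<longleftrightarrow> (\<exists>x. \<forall>i\<in>{1, 2, 3}. x \<in> e i \<longleftrightarrow> i \<in> J)"
  using assms unfolding venn_ordering_def by (rule conjunct1, elim conjE allE impE) assumption+

text \<open>A region is non-empty iff some point has exactly the incidence pattern \<open>J\<close>.
  In this form a Venn diagram can be transported along maps of points without handling indexed
  intersections and unions.\<close>

lemma satisfies_venn_iff: "satisfies_venn V G \<longleftrightarrow> (\<exists>e. venn_ordering V (edges G) e)"
proof -
  \<comment> \<open>Stated for an arbitrary index set \<open>N\<close> in place of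
    \<open>{1, 2, 3}\<close>, which keeps the bounded quantifiers folded.\<close>
  have region: "(\<Inter>i\<in>J. e i) - (\<Union>i\<in>N - J. e i) \<noteq> {} \<longleftrightarrow> (\<exists>x. \<forall>i\<in>N. x \<in> e i \<longleftrightarrow> i \<in> J)"
    if "J \<noteq> {}" "J \<subseteq> N" for J N and e :: "nat \<Rightarrow> 'a set"
  proof -
    have "x \<in> (\<Inter>i\<in>J. e i) - (\<Union>i\<in>N - J. e i) \<longleftrightarrow> (\<forall>i\<in>N. x \<in> e i \<longleftrightarrow> i \<in> J)" for x
      using that by blast
    then show ?thesis by (simp only: ex_in_conv[symmetric])
  qed
  have "(J \<noteq> {} \<and> J \<subseteq> N \<longrightarrow> V J = ((\<Inter>i\<in>J. e i) - (\<Union>i\<in>N - J. e i) \<noteq> {})) \<longleftrightarrow>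
      (J \<noteq> {} \<longrightarrow> J \<subseteq> N \<longrightarrow> V J = (\<exists>x. \<forall>i\<in>N. x \<in> e i \<longleftrightarrow> i \<in> J))" for J N and e :: "nat \<Rightarrow> 'a set"
    using region by metis
  then show ?thesis
    unfolding satisfies_venn_def venn_ordering_def by (simp only:)
qed

lemma satisfies_venn_imageI:
  assumes inj: "inj_on \<phi> (\<Union>(edges G))" and edges: "edges G' = (`) \<phi> ` edges G"
    and "satisfies_venn V G"
  shows "satisfies_venn V G'"
proof -
  obtain e where "venn_ordering V (edges G) e"
    using assms(3) unfolding satisfies_venn_iff ..
  note e = venn_orderingD[OF this]
  have sub: "e i \<subseteq> \<Union>(edges G)" if "i \<in> {1, 2, 3}" for i
    using e(1) that by (auto simp: bij_betw_def)
  have mem: "\<phi> x \<in> \<phi> ` e i \<longleftrightarrow> x \<in> e i" if "i \<in> {1, 2, 3}" "x \<in> \<Union>(edges G)" for i x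
    using inj_on_image_mem_iff[OF inj that(2) sub[OF that(1)]] .
  have "bij_betw ((`) \<phi> \<circ> e) {1, 2, 3} (edges G')"
    unfolding edges
    by (rule bij_betw_trans[OF e(1) inj_on_imp_bij_betw]) (rule inj_on_image[OF inj])
  moreover have "V J \<longleftrightarrow> (\<exists>x. \<forall>i\<in>{1, 2, 3}. x \<in> ((`) \<phi> \<circ> e) i \<longleftrightarrow> i \<in> J)"
    if J: "J \<noteq> {}" "J \<subseteq> {1, 2, 3}" for J
  proof -
    have "(\<exists>x. \<forall>i\<in>N. x \<in> e i \<longleftrightarrow> i \<in> J) \<longleftrightarrow> (\<exists>x. \<forall>i\<in>N. x \<in> \<phi> ` e i \<longleftrightarrow> i \<in> J)"
      if N: "J \<subseteq> N" and sub: "\<And>i. i \<in> N \<Longrightarrow> e i \<subseteq> \<Union>(edges G)"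
        and mem: "\<And>i x. i \<in> N \<Longrightarrow> x \<in> \<Union>(edges G) \<Longrightarrow> \<phi> x \<in> \<phi> ` e i \<longleftrightarrow> x \<in> e i" for N
    proof -
      \<comment> \<open>Since \<open>J\<close> is non-empty, a point with pattern \<open>J\<close>
        lies in some edge, hence in the set on which \<phi> is injective.\<close>
      obtain j where j: "j \<in> J" "j \<in> N" using J(1) N by blast
      show ?thesis
      proof
        assume "\<exists>x. \<forall>i\<in>N. x \<in> e i \<longleftrightarrow> i \<in> J"
        then obtain x where x: "\<forall>i\<in>N. x \<in> e i \<longleftrightarrow> i \<in> J" ..
        then have "x \<in> \<Union>(edges G)" using j sub by blast
        then show "\<exists>x. \<forall>i\<in>N. x \<in> \<phi> ` e i \<longleftrightarrow> i \<in> J" using x mem by (intro exI[of _ "\<phi> x"]) simp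
      next
        assume "\<exists>x. \<forall>i\<in>N. x \<in> \<phi> ` e i \<longleftrightarrow> i \<in> J"
        then obtain y where y: "\<forall>i\<in>N. y \<in> \<phi> ` e i \<longleftrightarrow> i \<in> J" ..
        then obtain x where "x \<in> e j" "y = \<phi> x" using j by blast
        moreover have "x \<in> \<Union>(edges G)" using \<open>x \<in> e j\<close> j sub by blast
        ultimately show "\<exists>x. \<forall>i\<in>N. x \<in> e i \<longleftrightarrow> i \<in> J" using y mem by (intro exI[of _ x]) simp
      qed
    qed
    from this[OF J(2) sub mem] show ?thesis using e(2)[OF J] by simp
  qed
  ultimately have "venn_ordering V (edges G') ((`) \<phi> \<circ> e)" by (rule venn_orderingI)
  then show ?thesis
    unfolding satisfies_venn_iff by (rule exI[where P = "venn_ordering V (edges G')"])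
qed

lemma satisfies_venn_image:
  assumes inj: "inj_on \<phi> (\<Union>(edges G))" and edges: "edges G' = (`) \<phi> ` edges G"
  shows "satisfies_venn V G' \<longleftrightarrow> satisfies_venn V G"
proof
  let ?\<psi> = "inv_into (\<Union>(edges G)) \<phi>"
  have un: "\<Union>(edges G') = \<phi> ` \<Union>(edges G)" unfolding edges by blast
  have "(\<lambda>e. ?\<psi> ` \<phi> ` e) ` edges G = (\<lambda>e. e) ` edges G"
    by (intro image_cong refl inv_into_image_cancel[OF inj]) auto
  moreover have "(`) ?\<psi> ` (`) \<phi> ` edges G = (\<lambda>e. ?\<psi> ` \<phi> ` e) ` edges G" by (rule image_image)
  ultimately have "edges G = (`) ?\<psi> ` edges G'" by (simp add: edges)
  moreover have "inj_on ?\<psi> (\<Union>(edges G'))"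
    unfolding un by (rule inj_on_inv_into) simp
  ultimately show "satisfies_venn V G' \<Longrightarrow> satisfies_venn V G"
    by (simp only: satisfies_venn_imageI)
qed (rule satisfies_venn_imageI[OF assms])

lemma nonempty_subset_3_cases:
  assumes "J \<noteq> {}" and "J \<subseteq> {1, 2, 3 :: nat}"
  obtains "J = {1}" | "J = {2}" | "J = {3}" | "J = {1, 2}" | "J = {1, 3}" | "J = {2, 3}"
    | "J = {1, 2, 3}"
proof -
  have *: "J = (if 1 \<in> J then {1} else {}) \<union> (if 2 \<in> J then {2} else {}) \<union> (if 3 \<in> J then {3} else {})"
    using assms(2) by (auto split: if_splits)
  show ?thesis
    using that assms(1) * by (cases "1 \<in> J"; cases "2 \<in> J"; cases "3 \<in> J") (simp_all add: insert_commute)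
qed

lemma satisfies_venn_3:
  assumes "edges G = {a, b, c}" "a \<noteq> b" "b \<noteq> c" "a \<noteq> c"
    and "V {1} \<longleftrightarrow> a - b - c \<noteq> {}" "V {2} \<longleftrightarrow> b - a - c \<noteq> {}" "V {3} \<longleftrightarrow> c - a - b \<noteq> {}"
    and "V {1, 2} \<longleftrightarrow> a \<inter> b - c \<noteq> {}" "V {1, 3} \<longleftrightarrow> a \<inter> c - b \<noteq> {}" "V {2, 3} \<longleftrightarrow> b \<inter> c - a \<noteq> {}"
    and "V {1, 2, 3} \<longleftrightarrow> a \<inter> b \<inter> c \<noteq> {}"
  shows "satisfies_venn V G"
proof -
  let ?e = "\<lambda>i::nat. if i = 1 then a else if i = 2 then b else c"
  have "bij_betw ?e {1, 2, 3} (edges G)"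
    using assms(1-4) by (simp add: bij_betw_def insert_commute)
  moreover have "V J \<longleftrightarrow> (\<exists>x. \<forall>i\<in>{1, 2, 3}. x \<in> ?e i \<longleftrightarrow> i \<in> J)"
    if "J \<noteq> {}" "J \<subseteq> {1, 2, 3}" for J
    using that by (rule nonempty_subset_3_cases) (simp_all add: assms(5-) del: One_nat_def, blast+)
  ultimately have "venn_ordering V (edges G) ?e" by (rule venn_orderingI)
  then show ?thesis
    unfolding satisfies_venn_iff by (rule exI[where P = "venn_ordering V (edges G)"])
qed

text \<open>Symmetric in the three indices, so it can be read off from the edges of a motif in any
  order. It decides which of the two covers can host a motif above a triangle.\<close>

definition venn_parity :: "venn \<Rightarrow> bool" where
  "venn_parity V \<longleftrightarrow> (V {1, 2} \<noteq> (V {1, 3} \<noteq> V {2, 3}))"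

lemma venn_parity_eq:
  assumes "satisfies_venn V G" and "edges G = {a, b, c}" and "a \<noteq> b" "b \<noteq> c" "a \<noteq> c"
  shows "venn_parity V \<longleftrightarrow>
    ((a \<inter> b - c \<noteq> {}) \<noteq> ((a \<inter> c - b \<noteq> {}) \<noteq> (b \<inter> c - a \<noteq> {})))"
proof -
  obtain e where "venn_ordering V {a, b, c} e"
    using assms(1) unfolding satisfies_venn_iff assms(2) ..
  note e = venn_orderingD[OF this]
  have "V {1, 2} \<longleftrightarrow> e 1 \<inter> e 2 - e 3 \<noteq> {}" "V {1, 3} \<longleftrightarrow> e 1 \<inter> e 3 - e 2 \<noteq> {}"
    "V {2, 3} \<longleftrightarrow> e 2 \<inter> e 3 - e 1 \<noteq> {}"
    by (subst e(2); auto)+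
  then have par: "venn_parity V \<longleftrightarrow>
      ((e 1 \<inter> e 2 - e 3 \<noteq> {}) \<noteq> ((e 1 \<inter> e 3 - e 2 \<noteq> {}) \<noteq> (e 2 \<inter> e 3 - e 1 \<noteq> {})))"
    by (simp add: venn_parity_def)
  have img: "{e 1, e 2, e 3} = {a, b, c}" using e(1) by (auto simp: bij_betw_def)
  moreover have "e 1 \<noteq> e 2" "e 1 \<noteq> e 3" "e 2 \<noteq> e 3"
    using e(1) by (auto simp: bij_betw_def inj_on_def)
  ultimately consider "e 1 = a" "e 2 = b" "e 3 = c" | "e 1 = a" "e 2 = c" "e 3 = b"
    | "e 1 = b" "e 2 = a" "e 3 = c" | "e 1 = b" "e 2 = c" "e 3 = a"
    | "e 1 = c" "e 2 = a" "e 3 = b" | "e 1 = c" "e 2 = b" "e 3 = a"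
    by (metis insert_iff singletonD)
  then show ?thesis unfolding par by cases (simp_all add: Int_commute, argo+)
qed

text \<open>With neither a private point nor a point shared with \<open>j\<close> alone, all points
  of edge \<open>i\<close> would lie in edge \<open>k\<close>, in every realization of
  \<open>V\<close>.\<close>

lemma nondegenerate_private:
  assumes "\<not> degenerate V" and ijk: "{i, j, k} = {1, 2, 3}" and "\<not> V {i}"
  shows "V {i, j}"
proof (rule ccontr)
  assume "\<not> V {i, j}"
  obtain G :: "nat hypergraph" where G: "satisfies_venn V G"
    "\<forall>e\<in>edges G. \<forall>e'\<in>edges G. e \<noteq> e' \<longrightarrow> \<not> e \<subseteq> e'"
    using assms(1) unfolding degenerate_def by metis
  obtain e where "venn_ordering V (edges G) e"
    using G(1) unfolding satisfies_venn_iff ..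
  note e = venn_orderingD[OF this]
  have ne: "i \<noteq> j" "j \<noteq> k" "i \<noteq> k"
    using arg_cong[OF ijk, of card] by (auto simp: card_insert_if split: if_splits)
  have "e i \<subseteq> e k"
  proof
    fix x assume "x \<in> e i"
    show "x \<in> e k"
    proof (rule ccontr)
      assume "x \<notin> e k"
      have "\<not> (\<forall>l\<in>{i, j, k}. x \<in> e l \<longleftrightarrow> l \<in> {i})" "\<not> (\<forall>l\<in>{i, j, k}. x \<in> e l \<longleftrightarrow> l \<in> {i, j})"
        using e(2)[folded ijk, of "{i}"] e(2)[folded ijk, of "{i, j}"] \<open>\<not> V {i}\<close> \<open>\<not> V {i, j}\<close>
        by (metis empty_subsetI insert_subset insertI1 insert_not_empty insertI2)+
      then show False using \<open>x \<in> e i\<close> \<open>x \<notin> e k\<close> ne by auto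
    qed
  qed
  moreover have "e i \<in> edges G" "e k \<in> edges G" "e i \<noteq> e k"
    using e(1) ijk ne unfolding bij_betw_def inj_on_def by blast+
  ultimately show False using G(2) by blast
qed

section \<open>Motif counts of the two covers\<close>

text \<open>\<open>(u, v, i, s)\<close> stands for the lift of the arc from \<open>u\<close> to
  \<open>v\<close> in class \<open>i\<close> whose tail lies on sheet \<open>s\<close>.\<close>

type_synonym label = "nat \<times> nat \<times> nat \<times> bool"

datatype cover_vertex = Core nat nat bool | Apex | Private label

definition next_class :: "nat \<Rightarrow> nat" where
  "next_class i = (if i = 2 then 0 else Suc i)"

lemma next_class_simps [simp]:
  "next_class 0 = 1" "next_class 1 = 2" "next_class 2 = 0"
  by (simp_all add: next_class_def)

text \<open>On booleans, \<open>\<noteq>\<close> is addition modulo 2. Classes count from 0 and Venn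
  indices from 1, hence \<open>Suc i\<close>.\<close>

fun cover_edge :: "venn \<Rightarrow> bool \<Rightarrow> label \<Rightarrow> cover_vertex set" where
  "cover_edge V \<sigma> (u, v, i, s) =
     {Core u i s, Core v (next_class i) (s \<noteq> (\<sigma> \<and> i = 2))} \<union>
     (if V {1, 2, 3} then {Apex} else {}) \<union> (if V {Suc i} then {Private (u, v, i, s)} else {})"

definition labels :: "(nat \<times> nat) set \<Rightarrow> label set" where
  "labels D = {(u, v, i, s). (u, v) \<in> D \<and> i < 3}"

lemma finite_labels: "finite D \<Longrightarrow> finite (labels D)"
proof -
  assume "finite D"
  then have "finite ((\<lambda>((u, v), i, s). (u, v, i, s)) ` (D \<times> {..<3 :: nat} \<times> (UNIV :: bool set)))" by simp
  moreover have "labels D \<subseteq> (\<lambda>((u, v), i, s). (u, v, i, s)) ` (D \<times> {..<3} \<times> UNIV)"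
    unfolding labels_def by force
  ultimately show ?thesis by (rule rev_finite_subset)
qed

text \<open>The two core vertices already determine the label. Apex and private vertices are cut
  away by \<open>core\<close>, and the classes tell the tail from the head.\<close>

lemma inj_on_cover_edge: "inj_on (cover_edge V \<sigma>) (labels D)"
proof (rule inj_onI)
  fix l l' assume l: "l \<in> labels D" "l' \<in> labels D" and eq: "cover_edge V \<sigma> l = cover_edge V \<sigma> l'"
  obtain u v i s where [simp]: "l = (u, v, i, s)" by (cases l)
  obtain u' v' i' s' where [simp]: "l' = (u', v', i', s')" by (cases l')
  define core where "core = {x. \<exists>u i s. x = Core u i s}"
  have core: "({x, y} \<union> X \<union> Y) \<inter> core = {x, y}"
    if "x \<in> core" "y \<in> core" "X \<inter> core = {}" "Y \<inter> core = {}" for x y X Y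
    using that by blast
  have "cover_edge V \<sigma> (u, v, i, s) \<inter> core = {Core u i s, Core v (next_class i) (s \<noteq> (\<sigma> \<and> i = 2))}" for u v i s
    unfolding cover_edge.simps by (rule core) (simp_all add: core_def)
  then have "{Core u i s, Core v (next_class i) (s \<noteq> (\<sigma> \<and> i = 2))} =
      {Core u' i' s', Core v' (next_class i') (s' \<noteq> (\<sigma> \<and> i' = 2))}"
    using eq by (metis \<open>l = (u, v, i, s)\<close> \<open>l' = (u', v', i', s')\<close>)
  \<comment> \<open>Two cyclic steps never return to the start when there are three classes, so tail
    and head cannot have been exchanged.\<close>
  moreover have "\<not> (i = next_class i' \<and> next_class i = i')"
    using l by (auto simp: labels_def next_class_def split: if_splits)
  ultimately have "u = u' \<and> i = i' \<and> s = s' \<and> v = v'"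
    unfolding doubleton_eq_iff by blast
  then show "l = l'" by simp
qed

section \<open>Changes of sheets\<close>

fun regauge :: "(nat \<Rightarrow> nat \<Rightarrow> bool) \<Rightarrow> label \<Rightarrow> label" where
  "regauge g (u, v, i, s) = (u, v, i, s \<noteq> g u i)"

fun regauge_vertex :: "(nat \<Rightarrow> nat \<Rightarrow> bool) \<Rightarrow> cover_vertex \<Rightarrow> cover_vertex" where
  "regauge_vertex g (Core u i s) = Core u i (s \<noteq> g u i)"
| "regauge_vertex g Apex = Apex"
| "regauge_vertex g (Private l) = Private (regauge g l)"

fun base :: "label \<Rightarrow> nat \<times> nat \<times> nat" where
  "base (u, v, i, s) = (u, v, i)"

lemma regauge_regauge [simp]: "regauge g (regauge g l) = l"
  by (cases l) auto

lemma base_regauge [simp]: "base (regauge g l) = base l"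
  by (cases l) simp

lemma regauge_in_labels [simp]: "regauge g l \<in> labels D \<longleftrightarrow> l \<in> labels D"
  by (cases l) (simp add: labels_def)

lemma regauge_vertex_regauge_vertex: "regauge_vertex g (regauge_vertex g x) = x"
  by (cases x) auto

text \<open>The change of sheets \<open>g\<close> turns the untwisted cover of the base edges \<open>B\<close> into the twisted one.\<close>

definition trivializes :: "(nat \<Rightarrow> nat \<Rightarrow> bool) \<Rightarrow> (nat \<times> nat \<times> nat) set \<Rightarrow> bool" where
  "trivializes g B \<longleftrightarrow> (\<forall>(u, v, i)\<in>B. g v (next_class i) = (g u i \<noteq> (i = 2)))"

text \<open>The tail moves by \<open>g u i\<close> and the head by
  \<open>g v (next_class i)\<close>. For a trivializing \<open>g\<close> these agree except in class
  2, where the discrepancy is exactly what toggling \<sigma> produces.\<close>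

lemma cover_edge_regauge:
  assumes "trivializes g B" and "base l \<in> B"
  shows "cover_edge V (\<not> \<sigma>) (regauge g l) = regauge_vertex g ` cover_edge V \<sigma> l"
proof -
  obtain u v i s where l: "l = (u, v, i, s)" by (cases l)
  have "g v (next_class i) = (g u i \<noteq> (i = 2))"
    using assms unfolding l trivializes_def by fastforce
  then have "((s \<noteq> g u i) \<noteq> (\<not> \<sigma> \<and> i = 2)) = ((s \<noteq> (\<sigma> \<and> i = 2)) \<noteq> g v (next_class i))"
    by argo
  then show ?thesis by (simp add: l image_Un)
qed

definition is_base_triangle :: "(nat \<times> nat \<times> nat) set \<Rightarrow> bool" where
  "is_base_triangle B \<longleftrightarrow> (\<exists>u v w. B = {(u, v, 0), (v, w, 1), (w, u, 2)})"

text \<open>Going once around the classes, \<open>g\<close> flips on the passage from class 2 to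
  class 0 and must flip back somewhere. Unless the arcs close up to a triangle, there is a gap where
  it can do so. Labels of a motif may share a base edge, hence \<open>card B \<le> 3\<close> rather
  than equality.\<close>

lemma ex_trivializes:
  assumes "card B \<le> 3" "finite B" and cls: "\<forall>(u, v, i)\<in>B. i < 3" and "\<not> is_base_triangle B"
  shows "\<exists>g. trivializes g B"
proof (cases "\<forall>i<3. \<exists>u v. (u, v, i) \<in> B")
  case False
  then obtain i where "i < 3" and i: "\<And>u v. (u, v, i) \<notin> B" by blast
  then consider "i = 0" | "i = 1" | "i = 2" by linarith
  then show ?thesis
  proof cases
    \<comment> \<open>In this and the next case \<open>g\<close> flips back across the absent class.
      If class 2 is absent, no flip is required and a constant works.\<close>
    case 1
    then have "trivializes (\<lambda>x j. j = 0) B"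
      using i cls unfolding trivializes_def by (fastforce simp: next_class_def less_Suc_eq numeral_3_eq_3 split: if_splits)
    then show ?thesis by (rule exI[where P = "\<lambda>g. trivializes g B"])
  next
    case 2
    then have "trivializes (\<lambda>x j. j < 2) B"
      using i cls unfolding trivializes_def by (fastforce simp: next_class_def less_Suc_eq numeral_3_eq_3 split: if_splits)
    then show ?thesis by (rule exI[where P = "\<lambda>g. trivializes g B"])
  next
    case 3
    then have "trivializes (\<lambda>x j. False) B"
      using i cls unfolding trivializes_def by (fastforce simp: next_class_def less_Suc_eq numeral_3_eq_3 split: if_splits)
    then show ?thesis by (rule exI[where P = "\<lambda>g. trivializes g B"])
  qed
next
  case True
  then obtain u v v' w w' u' where B: "(u, v, 0) \<in> B" "(v', w, 1) \<in> B" "(w', u', 2) \<in> B"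
    by (metis numeral_3_eq_3 zero_less_numeral one_less_numeral_iff semiring_norm(77) lessI numeral_2_eq_2)
  \<comment> \<open>One arc per class already exhausts the at most three elements of
    \<open>B\<close>.\<close>
  have "{(u, v, 0), (v', w, 1), (w', u', 2)} = B"
    by (rule card_subset_eq[OF assms(2)]) (use assms(1) B card_mono[OF assms(2), of "{(u, v, 0), (v', w, 1), (w', u', 2)}"] in auto)
  then have B: "B = {(u, v, 0), (v', w, 1), (w', u', 2)}" by simp
  \<comment> \<open>At one of the three junctions the arriving and the leaving arc use different
    vertices, and \<open>g\<close> may take different values there.\<close>
  consider "v \<noteq> v'" | "w \<noteq> w'" | "u \<noteq> u'"
    using assms(4) B unfolding is_base_triangle_def by blast
  then show ?thesis
  proof cases
    case 1
    then have "trivializes (\<lambda>x j. j = 0 \<or> j = 1 \<and> x = v) B"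
      unfolding trivializes_def B by (auto simp: next_class_def)
    then show ?thesis by (rule exI[where P = "\<lambda>g. trivializes g B"])
  next
    case 2
    then have "trivializes (\<lambda>x j. j < 2 \<or> j = 2 \<and> x = w) B"
      unfolding trivializes_def B by (auto simp: next_class_def)
    then show ?thesis by (rule exI[where P = "\<lambda>g. trivializes g B"])
  next
    case 3
    then have "trivializes (\<lambda>x j. j = 0 \<and> x = u') B"
      unfolding trivializes_def B by (auto simp: next_class_def)
    then show ?thesis by (rule exI[where P = "\<lambda>g. trivializes g B"])
  qed
qed

text \<open>Motifs are recorded by their labels, which is faithful by
  \<open>inj_on_cover_edge\<close>. The field \<open>verts\<close> is a placeholder, as
  \<open>satisfies_venn\<close> inspects edges only.\<close>

definition cover_motifs :: "venn \<Rightarrow> bool \<Rightarrow> (nat \<times> nat) set \<Rightarrow> label set set" where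
  "cover_motifs V \<sigma> D = {A. A \<subseteq> labels D \<and> card A = 3 \<and>
     satisfies_venn V \<lparr>verts = {}, edges = cover_edge V \<sigma> ` A\<rparr>}"

lemma card_cover_motifs_nontriangle:
  assumes "finite D"
  shows "card {A \<in> cover_motifs V False D. \<not> is_base_triangle (base ` A)} =
    card {A \<in> cover_motifs V True D. \<not> is_base_triangle (base ` A)}"
    (is "card (?M False) = card (?M True)")
proof -
  define gauge where "gauge B = (SOME g. trivializes g B)" for B
  define \<Phi> where "\<Phi> A = regauge (gauge (base ` A)) ` A" for A
  have gauge: "trivializes (gauge (base ` A)) (base ` A)"
    if "A \<subseteq> labels D" "card A = 3" "\<not> is_base_triangle (base ` A)" for A
  proof -
    have "finite A" using that(2) card.infinite by fastforce
    then have "\<exists>g. trivializes g (base ` A)"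
      using that by (intro ex_trivializes) (auto simp: labels_def intro: card_image_le[THEN order.trans])
    then show ?thesis unfolding gauge_def by (rule someI_ex)
  qed
  have base: "base ` \<Phi> A = base ` A" for A
    by (simp add: \<Phi>_def image_image)
  have involution: "\<Phi> (\<Phi> A) = A" for A
    unfolding \<Phi>_def[of "\<Phi> A"] base by (simp add: \<Phi>_def image_image)
  have "\<Phi> A \<in> ?M (\<not> \<sigma>)" if A: "A \<in> ?M \<sigma>" for \<sigma> A
  proof -
    let ?g = "gauge (base ` A)"
    have A': "A \<subseteq> labels D" "card A = 3" "\<not> is_base_triangle (base ` A)"
      "satisfies_venn V \<lparr>verts = {}, edges = cover_edge V \<sigma> ` A\<rparr>"
      using A by (auto simp: cover_motifs_def)
    note g = gauge[OF A'(1-3)]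
    have "cover_edge V (\<not> \<sigma>) (regauge ?g l) = regauge_vertex ?g ` cover_edge V \<sigma> l" if "l \<in> A" for l
      by (rule cover_edge_regauge[OF g imageI[OF that]])
    then have "cover_edge V (\<not> \<sigma>) ` \<Phi> A = (`) (regauge_vertex ?g) ` cover_edge V \<sigma> ` A"
      unfolding \<Phi>_def image_image by (rule image_cong[OF refl])
    moreover have "inj (regauge_vertex ?g)"
      by (metis injI regauge_vertex_regauge_vertex)
    ultimately have "satisfies_venn V \<lparr>verts = {}, edges = cover_edge V (\<not> \<sigma>) ` \<Phi> A\<rparr>"
      using satisfies_venn_imageI[OF _ _ A'(4), of "regauge_vertex ?g"]
      by (simp add: inj_on_subset)
    moreover have "\<Phi> A \<subseteq> labels D" using A'(1) by (auto simp: \<Phi>_def simp del: regauge.simps)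
    moreover have "card (\<Phi> A) = 3"
      unfolding \<Phi>_def using A'(2) by (simp add: card_image inj_on_inverseI[where g = "regauge (gauge (base ` A))"])
    ultimately show ?thesis using A'(3) base by (simp add: cover_motifs_def)
  qed
  from this[of _ True] this[of _ False] have "bij_betw \<Phi> (?M False) (?M True)"
    by (intro bij_betw_byWitness[where f' = \<Phi>]) (use involution in auto)
  then show ?thesis by (rule bij_betw_same_card)
qed

text \<open>The three pairs intersect according to the equations \<open>s1 = s2\<close>,
  \<open>s2 = s3\<close> and \<open>s1 = (s3 \<noteq> \<sigma>)\<close>. Adding them modulo 2
  cancels the sheets, so the number of equations that fail has the parity of \<sigma>.\<close>

lemma cover_motifs_triangle_parity:
  assumes A: "A \<in> cover_motifs V \<sigma> D" and "is_base_triangle (base ` A)"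
  shows "venn_parity V \<longleftrightarrow> \<not> \<sigma>"
proof -
  obtain u v w where uvw: "base ` A = {(u, v, 0), (v, w, 1), (w, u, 2)}"
    using assms(2) unfolding is_base_triangle_def by blast
  have A': "A \<subseteq> labels D" "card A = 3" "satisfies_venn V \<lparr>verts = {}, edges = cover_edge V \<sigma> ` A\<rparr>"
    using A by (auto simp: cover_motifs_def)
  have lift: "\<exists>s. (x, y, i, s) \<in> A" if "(x, y, i) \<in> base ` A" for x y i
    using that by (elim imageE, rename_tac l, case_tac l) auto
  obtain s1 s2 s3 where s: "(u, v, 0, s1) \<in> A" "(v, w, 1, s2) \<in> A" "(w, u, 2, s3) \<in> A"
    using lift[of u v 0] lift[of v w 1] lift[of w u 2] uvw by auto
  have finA: "finite A" using A'(2) card.infinite by fastforce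
  have "{(u, v, 0, s1), (v, w, 1, s2), (w, u, 2, s3)} = A"
    by (rule card_subset_eq[OF finA]) (use A'(2) s in auto)
  then have A_eq: "A = {(u, v, 0, s1), (v, w, 1, s2), (w, u, 2, s3)}" by simp
  let ?a = "cover_edge V \<sigma> (u, v, 0, s1)" and ?b = "cover_edge V \<sigma> (v, w, 1, s2)"
    and ?c = "cover_edge V \<sigma> (w, u, 2, s3)"
  have inj: "l \<noteq> l' \<Longrightarrow> cover_edge V \<sigma> l \<noteq> cover_edge V \<sigma> l'" if "l \<in> A" "l' \<in> A" for l l'
    using inj_on_cover_edge[of V \<sigma> D] A'(1) that unfolding inj_on_def by blast
  \<comment> \<open>Core vertices carry their class, so two of the edges can share only the core
    vertex at their junction. A common apex also lies in the third edge and is subtracted.\<close>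
  have "?a \<inter> ?b - ?c \<noteq> {} \<longleftrightarrow> s1 = s2" by (auto simp del: One_nat_def)
  moreover have "?b \<inter> ?c - ?a \<noteq> {} \<longleftrightarrow> s2 = s3" by (auto simp del: One_nat_def)
  moreover have "?a \<inter> ?c - ?b \<noteq> {} \<longleftrightarrow> s1 = (s3 \<noteq> \<sigma>)" by (auto simp del: One_nat_def)
  moreover have "venn_parity V \<longleftrightarrow> ((?a \<inter> ?b - ?c \<noteq> {}) \<noteq> ((?a \<inter> ?c - ?b \<noteq> {}) \<noteq> (?b \<inter> ?c - ?a \<noteq> {})))"
  proof (rule venn_parity_eq[OF A'(3)])
    show "?a \<noteq> ?b" "?b \<noteq> ?c" "?a \<noteq> ?c"
      by (rule inj; use s in simp)+
  qed (simp only: A_eq select_convs image_insert image_empty)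
  ultimately show ?thesis by argo
qed

text \<open>With the first sheet fixed, the regions \<open>{1, 2}\<close> and \<open>{2, 3}\<close>
  dictate the other two sheets. The region \<open>{1, 3}\<close> then comes out right because
  \<sigma> has the matching parity.\<close>

lemma cover_motifs_triangle_nonempty:
  assumes "\<not> degenerate V" and D: "(u, v) \<in> D" "(v, w) \<in> D" "(w, u) \<in> D"
  shows "\<exists>A \<in> cover_motifs V (\<not> venn_parity V) D. is_base_triangle (base ` A)"
proof -
  define \<sigma> where "\<sigma> \<longleftrightarrow> \<not> venn_parity V"
  define s2 :: bool where "s2 \<longleftrightarrow> V {1, 2}"
  define s3 where "s3 \<longleftrightarrow> (V {2, 3} = s2)"
  let ?l1 = "(u, v, 0, True) :: label" and ?l2 = "(v, w, 1, s2) :: label" and ?l3 = "(w, u, 2, s3) :: label"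
  let ?a = "cover_edge V \<sigma> ?l1" and ?b = "cover_edge V \<sigma> ?l2" and ?c = "cover_edge V \<sigma> ?l3"
  have V13: "V {1, 3} \<longleftrightarrow> (s3 \<noteq> \<sigma>)"
    unfolding \<sigma>_def s3_def s2_def venn_parity_def by argo
  have V23: "V {2, 3} \<longleftrightarrow> s2 = s3" by (auto simp: s3_def)
  have "V {1, 2} \<and> V {1, 3}" if "\<not> V {1}"
    using nondegenerate_private[OF assms(1), of 1 2 3] nondegenerate_private[OF assms(1), of 1 3 2] that
    by (auto simp: insert_commute)
  moreover have "V {1, 2} \<and> V {2, 3}" if "\<not> V {2}"
    using nondegenerate_private[OF assms(1), of 2 1 3] nondegenerate_private[OF assms(1), of 2 3 1] that
    by (auto simp: insert_commute)
  moreover have "V {1, 3} \<and> V {2, 3}" if "\<not> V {3}"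
    using nondegenerate_private[OF assms(1), of 3 1 2] nondegenerate_private[OF assms(1), of 3 2 1] that
    by (auto simp: insert_commute)
  \<comment> \<open>An edge without a private vertex shares both of its core vertices, so its single
    region is indeed empty.\<close>
  ultimately have priv: "V {1} \<or> V {1, 2} \<and> V {1, 3}" "V {2} \<or> V {1, 2} \<and> V {2, 3}"
      "V {3} \<or> V {1, 3} \<and> V {2, 3}"
    by blast+
  have suc: "Suc 0 = 1" "Suc 1 = 2" "Suc 2 = 3" by simp_all
  have L: "?l1 \<in> labels D" "?l2 \<in> labels D" "?l3 \<in> labels D"
    using D by (simp_all add: labels_def)
  have "satisfies_venn V \<lparr>verts = {}, edges = {?a, ?b, ?c}\<rparr>"
  proof (rule satisfies_venn_3[of _ ?a ?b ?c])
    show "?a \<noteq> ?b" "?b \<noteq> ?c" "?a \<noteq> ?c"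
      unfolding inj_on_eq_iff[OF inj_on_cover_edge L(1,2)] inj_on_eq_iff[OF inj_on_cover_edge L(2,3)]
        inj_on_eq_iff[OF inj_on_cover_edge L(1,3)] by simp_all
    show "V {1} \<longleftrightarrow> ?a - ?b - ?c \<noteq> {}" 
    proof (cases "V {1}")
      case True
      then have "Private ?l1 \<in> ?a - ?b - ?c" by (simp add: suc del: One_nat_def)
      then show ?thesis using True by blast
    next
      case False
      then have "?a - ?b - ?c = {}"
        using priv(1) V13 s2_def by (auto simp: suc simp del: One_nat_def)
      then show ?thesis using False by simp
    qed
    show "V {2} \<longleftrightarrow> ?b - ?a - ?c \<noteq> {}" 
    proof (cases "V {2}")
      case True
      then have "Private ?l2 \<in> ?b - ?a - ?c" by (simp add: suc del: One_nat_def)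
      then show ?thesis using True by blast
    next
      case False
      then have "?b - ?a - ?c = {}"
        using priv(2) V23 s2_def by (auto simp: suc simp del: One_nat_def)
      then show ?thesis using False by simp
    qed
    show "V {3} \<longleftrightarrow> ?c - ?a - ?b \<noteq> {}" 
    proof (cases "V {3}")
      case True
      then have "Private ?l3 \<in> ?c - ?a - ?b" by (simp add: suc del: One_nat_def)
      then show ?thesis using True by blast
    next
      case False
      then have "?c - ?a - ?b = {}"
        using priv(3) V13 V23 by (auto simp: suc simp del: One_nat_def)
      then show ?thesis using False by simp
    qed
    show "V {1, 2} \<longleftrightarrow> ?a \<inter> ?b - ?c \<noteq> {}" using s2_def by (auto simp: suc simp del: One_nat_def)
    show "V {1, 3} \<longleftrightarrow> ?a \<inter> ?c - ?b \<noteq> {}" using V13 by (auto simp: suc simp del: One_nat_def)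
    show "V {2, 3} \<longleftrightarrow> ?b \<inter> ?c - ?a \<noteq> {}" using V23 by (auto simp: suc simp del: One_nat_def)
    show "V {1, 2, 3} \<longleftrightarrow> ?a \<inter> ?b \<inter> ?c \<noteq> {}" by (auto simp: suc simp del: One_nat_def)
  qed simp
  then have "{?l1, ?l2, ?l3} \<in> cover_motifs V \<sigma> D"
    using D by (simp add: cover_motifs_def labels_def)
  moreover have "is_base_triangle (base ` {?l1, ?l2, ?l3})"
    by (auto simp: is_base_triangle_def)
  ultimately show ?thesis unfolding \<sigma>_def by blast
qed

lemma cover_motifs_detect_triangle:
  assumes "\<not> degenerate V" and "finite D"
  shows "card (cover_motifs V False D) \<noteq> card (cover_motifs V True D) \<longleftrightarrow>
    (\<exists>u v w. (u, v) \<in> D \<and> (v, w) \<in> D \<and> (w, u) \<in> D)"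
proof -
  define T where "T \<sigma> = {A \<in> cover_motifs V \<sigma> D. is_base_triangle (base ` A)}" for \<sigma>
  define N where "N \<sigma> = {A \<in> cover_motifs V \<sigma> D. \<not> is_base_triangle (base ` A)}" for \<sigma>
  have fin: "finite (cover_motifs V \<sigma> D)" for \<sigma>
    by (rule finite_subset[of _ "Pow (labels D)"]) (auto simp: cover_motifs_def finite_labels assms(2))
  have split: "card (cover_motifs V \<sigma> D) = card (T \<sigma>) + card (N \<sigma>)" for \<sigma>
  proof -
    have "cover_motifs V \<sigma> D = T \<sigma> \<union> N \<sigma>" by (auto simp: T_def N_def)
    moreover have "card (T \<sigma> \<union> N \<sigma>) = card (T \<sigma>) + card (N \<sigma>)"
      using fin[of \<sigma>] by (intro card_Un_disjoint) (auto simp: T_def N_def)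
    ultimately show ?thesis by simp
  qed
  have finT: "finite (T \<sigma>)" for \<sigma> using fin[of \<sigma>] by (simp add: T_def)
  have empty: "T (venn_parity V) = {}"
    using cover_motifs_triangle_parity[of _ V "venn_parity V" D] by (auto simp: T_def)
  have "card (N False) = card (N True)"
    unfolding N_def by (rule card_cover_motifs_nontriangle[OF assms(2)])
  then have "card (cover_motifs V False D) \<noteq> card (cover_motifs V True D) \<longleftrightarrow> card (T False) \<noteq> card (T True)"
    by (simp add: split)
  \<comment> \<open>One of the two counts above triangles is 0, so they differ iff the other one is
    positive.\<close>
  also have "\<dots> \<longleftrightarrow> card (T (\<not> venn_parity V)) \<noteq> 0"
    using empty by (cases "venn_parity V") auto
  also have "\<dots> \<longleftrightarrow> (\<exists>u v w. (u, v) \<in> D \<and> (v, w) \<in> D \<and> (w, u) \<in> D)"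
  proof
    assume "card (T (\<not> venn_parity V)) \<noteq> 0"
    then obtain A where "A \<in> T (\<not> venn_parity V)"
      by (cases "T (\<not> venn_parity V) = {}") auto
    then have "A \<subseteq> labels D" and "is_base_triangle (base ` A)"
      by (auto simp: T_def cover_motifs_def)
    then obtain u v w where "base ` A = {(u, v, 0), (v, w, 1), (w, u, 2)}"
      unfolding is_base_triangle_def by blast
    moreover have "base ` A \<subseteq> {(u, v, i). (u, v) \<in> D}"
      using \<open>A \<subseteq> labels D\<close> by (auto simp: labels_def)
    ultimately show "\<exists>u v w. (u, v) \<in> D \<and> (v, w) \<in> D \<and> (w, u) \<in> D" by auto
  next
    assume "\<exists>u v w. (u, v) \<in> D \<and> (v, w) \<in> D \<and> (w, u) \<in> D"
    then obtain u v w where "(u, v) \<in> D" "(v, w) \<in> D" "(w, u) \<in> D" by blast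
    from cover_motifs_triangle_nonempty[OF assms(1) this] have "T (\<not> venn_parity V) \<noteq> {}"
      unfolding T_def by blast
    then show "card (T (\<not> venn_parity V)) \<noteq> 0" using finT by simp
  qed
  finally show ?thesis .
qed

section \<open>Encoding the covers\<close>

text \<open>Each graph vertex owns a block of six numbers, for three classes times two sheets. The
  numbering \<open>p\<close> of the private vertices stays open, because their names are handed out
  while the edges are written.\<close>

fun vertex_code :: "nat \<Rightarrow> (label \<Rightarrow> nat) \<Rightarrow> cover_vertex \<Rightarrow> nat" where
  "vertex_code n p (Core u i s) = 6 * u + (2 * i + of_bool s)"
| "vertex_code n p Apex = 6 * n"
| "vertex_code n p (Private l) = p l"

fun has_private :: "venn \<Rightarrow> label \<Rightarrow> bool" where
  "has_private V (u, v, i, s) = V {Suc i}"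

text \<open>The image of \<open>cover_edge\<close> under \<open>vertex_code\<close>, in the order in
  which the program writes it; \<open>w\<close> is the next free private name.\<close>

definition edge_list :: "venn \<Rightarrow> bool \<Rightarrow> nat \<Rightarrow> label \<Rightarrow> nat \<Rightarrow> nat list" where
  "edge_list V \<sigma> n = (\<lambda>(u, v, i, s) w.
     [6 * u + (2 * i + of_bool s), 6 * v + (2 * next_class i + of_bool (s \<noteq> (\<sigma> \<and> i = 2)))] @
     (if V {1, 2, 3} then [6 * n] else []) @ (if V {Suc i} then [w] else []))"

fun edge_lists :: "venn \<Rightarrow> bool \<Rightarrow> nat \<Rightarrow> label list \<Rightarrow> nat \<Rightarrow> nat list list" where
  "edge_lists V \<sigma> n [] w = []"
| "edge_lists V \<sigma> n (l # ls) w =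
     edge_list V \<sigma> n l w # edge_lists V \<sigma> n ls (w + of_bool (has_private V l))"

definition private_count :: "venn \<Rightarrow> label list \<Rightarrow> nat" where
  "private_count V ls = length (filter (has_private V) ls)"

lemma private_count_simps [simp]:
  "private_count V [] = 0"
  "private_count V (l # ls) = of_bool (has_private V l) + private_count V ls"
  "private_count V (ls @ ls') = private_count V ls + private_count V ls'"
  by (simp_all add: private_count_def)

lemma length_edge_lists [simp]: "length (edge_lists V \<sigma> n ls w) = length ls"
  by (induction ls arbitrary: w) simp_all

lemma edge_lists_append:
  "edge_lists V \<sigma> n (ls @ ls') w =
     edge_lists V \<sigma> n ls w @ edge_lists V \<sigma> n ls' (w + private_count V ls)"
  by (induction ls arbitrary: w) (simp_all add: add.assoc)

lemma set_edge_list: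
  "p l = w \<Longrightarrow> set (edge_list V \<sigma> n l w) = vertex_code n p ` cover_edge V \<sigma> l"
  by (cases l) (simp add: edge_list_def image_Un insert_commute)

text \<open>\<open>p\<close> is the running counter read as a function on labels. Because the labels
  are distinct, the value at the head can be set without disturbing the edges of the tail.\<close>

lemma edge_lists_cover_edge:
  assumes "distinct ls"
  shows "\<exists>p. inj_on p {l \<in> set ls. has_private V l} \<and>
    p ` {l \<in> set ls. has_private V l} = {w..<w + private_count V ls} \<and>
    map set (edge_lists V \<sigma> n ls w) = map (\<lambda>l. vertex_code n p ` cover_edge V \<sigma> l) ls"
  using assms
proof (induction ls arbitrary: w)
  case Nil
  show ?case by simp
next
  case (Cons l ls)
  let ?w = "w + of_bool (has_private V l)"
  obtain p where p: "inj_on p {l \<in> set ls. has_private V l}"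
    "p ` {l \<in> set ls. has_private V l} = {?w..<?w + private_count V ls}"
    "map set (edge_lists V \<sigma> n ls ?w) = map (\<lambda>l. vertex_code n p ` cover_edge V \<sigma> l) ls"
    using Cons.IH[of ?w] Cons.prems by auto
  let ?p = "p(l := w)"
  have l: "l \<notin> set ls" using Cons.prems by simp
  have rest: "vertex_code n ?p ` cover_edge V \<sigma> l' = vertex_code n p ` cover_edge V \<sigma> l'" if "l' \<in> set ls" for l'
  proof (rule image_cong[OF refl])
    fix x assume "x \<in> cover_edge V \<sigma> l'"
    then have "x \<noteq> Private l" using l that by (cases l') (auto split: if_splits)
    then show "vertex_code n ?p x = vertex_code n p x" by (cases x) auto
  qed
  have img: "?p ` {l' \<in> set ls. has_private V l'} = {?w..<?w + private_count V ls}"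
    unfolding p(2)[symmetric] using l by (intro image_cong) auto
  have inj: "inj_on ?p {l' \<in> set ls. has_private V l'}"
    using p(1) l by (auto simp: inj_on_def)
  have "map set (edge_lists V \<sigma> n (l # ls) w) = map (\<lambda>l. vertex_code n ?p ` cover_edge V \<sigma> l) (l # ls)"
    using set_edge_list[of ?p l w V \<sigma> n] rest p(3) by simp
  moreover have "inj_on ?p {l' \<in> set (l # ls). has_private V l'} \<and>
    ?p ` {l' \<in> set (l # ls). has_private V l'} = {w..<w + private_count V (l # ls)}"
  proof (cases "has_private V l")
    case True
    then have eq: "{l' \<in> set (l # ls). has_private V l'} = insert l {l' \<in> set ls. has_private V l'}" by auto
    have "{w..<w + private_count V (l # ls)} = insert w {?w..<?w + private_count V ls}"
      using True by auto
    moreover have "?p ` {l' \<in> set (l # ls). has_private V l'} = insert w {?w..<?w + private_count V ls}"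
      unfolding eq image_insert img by simp
    moreover have "inj_on ?p {l' \<in> set (l # ls). has_private V l'}"
      unfolding eq inj_on_insert using inj img True l by auto
    ultimately show ?thesis by metis
  next
    case False
    then have "{l' \<in> set (l # ls). has_private V l'} = {l' \<in> set ls. has_private V l'}" by auto
    then show ?thesis using inj img False by simp
  qed
  ultimately show ?case by blast
qed

text \<open>The two core codes differ modulo 6, since their classes are consecutive. The apex and
  the private vertex have numbers from \<open>6 * n\<close> on, in this order.\<close>

lemma distinct_edge_list:
  assumes "fst l < n" "fst (snd l) < n" "fst (snd (snd l)) < 3" "6 * n + of_bool (V {1, 2, 3}) \<le> w"
  shows "distinct (edge_list V \<sigma> n l w)" and "edge_list V \<sigma> n l w \<noteq> []"
    and "length (edge_list V \<sigma> n l w) \<le> 4"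
proof -
  obtain u v i s where l: "l = (u, v, i, s)" by (cases l)
  obtain a where a: "2 * i + of_bool s = a" "a < 6" using assms(3) by (simp add: l)
  obtain b where b: "2 * next_class i + of_bool (s \<noteq> (\<sigma> \<and> i = 2)) = b" "b < 6"
    using assms(3) by (simp add: l next_class_def)
  have "a div 2 = i" "b div 2 = next_class i" using a(1) b(1) by auto
  then have "a \<noteq> b" by (auto simp: next_class_def split: if_splits)
  have "6 * u + a \<noteq> 6 * v + b"
  proof
    assume "6 * u + a = 6 * v + b"
    then have "(6 * u + a) mod 6 = (6 * v + b) mod 6" by simp
    then show False using a(2) b(2) \<open>a \<noteq> b\<close> by simp
  qed
  moreover have "6 * u + a < 6 * n" "6 * v + b < 6 * n" using assms(1,2) a(2) b(2) by (simp_all add: l)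
  moreover have "edge_list V \<sigma> n l w = [6 * u + a, 6 * v + b] @
      (if V {1, 2, 3} then [6 * n] else []) @ (if V {Suc i} then [w] else [])"
    by (simp only: l edge_list_def prod.case a(1) b(1))
  ultimately show "distinct (edge_list V \<sigma> n l w)" and "edge_list V \<sigma> n l w \<noteq> []"
    and "length (edge_list V \<sigma> n l w) \<le> 4"
    using assms(4) by (auto split: if_splits)
qed

lemma edge_lists_wf:
  assumes "\<And>u v i s. (u, v, i, s) \<in> set ls \<Longrightarrow> u < n \<and> v < n \<and> i < 3"
    and "6 * n + of_bool (V {1, 2, 3}) \<le> w"
    and "e \<in> set (edge_lists V \<sigma> n ls w)"
  shows "distinct e \<and> e \<noteq> [] \<and> length e \<le> 4"
  using assms
proof (induction ls arbitrary: w)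
  case (Cons l ls)
  from Cons.prems(3) consider "e = edge_list V \<sigma> n l w"
    | "e \<in> set (edge_lists V \<sigma> n ls (w + of_bool (has_private V l)))" by auto
  then show ?case
  proof cases
    case 1
    obtain u v i s where "l = (u, v, i, s)" by (cases l)
    then have "fst l < n" "fst (snd l) < n" "fst (snd (snd l)) < 3"
      using Cons.prems(1)[of u v i s] by simp_all
    then show ?thesis
      using distinct_edge_list[of l n V w \<sigma>] Cons.prems(2) unfolding 1 by blast
  next
    case 2
    show ?thesis
    proof (rule Cons.IH[OF _ _ 2])
      show "u < n \<and> v < n \<and> i < 3" if "(u, v, i, s) \<in> set ls" for u v i s
        using Cons.prems(1)[of u v i s] that by simp
      show "6 * n + of_bool (V {1, 2, 3}) \<le> w + of_bool (has_private V l)"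
        using Cons.prems(2) by simp
    qed
  qed
qed simp

lemma vertex_code_Core_image:
  "vertex_code n p ` {Core u i s | u i s. u < m \<and> i < 3} = {..<6 * m}"
proof (intro equalityI subsetI)
  fix y assume "y \<in> {..<6 * m}"
  have "y = vertex_code n p (Core (y div 6) (y mod 6 div 2) (odd y))"
  proof -
    have "y mod 6 mod 2 = y mod 2" by (rule mod_mod_cancel) simp
    then have "y = 6 * (y div 6) + (2 * (y mod 6 div 2) + y mod 2)"
      by (metis mult_div_mod_eq)
    moreover have "y mod 2 = of_bool (odd y)" by (simp add: mod2_eq_if)
    ultimately show ?thesis by (simp only: vertex_code.simps)
  qed
  moreover have "y mod 6 div 2 < 3" by presburger
  ultimately show "y \<in> vertex_code n p ` {Core u i s | u i s. u < m \<and> i < 3}"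
    using \<open>y \<in> {..<6 * m}\<close>
    by (intro image_eqI[of _ _ "Core (y div 6) (y mod 6 div 2) (odd y)"]) auto
qed auto

lemma inj_on_vertex_code_Core: "inj_on (vertex_code n p) {Core u i s | u i s. u < m \<and> i < 3}"
proof (rule inj_onI)
  fix x y assume "x \<in> {Core u i s | u i s. u < m \<and> i < 3}" "y \<in> {Core u i s | u i s. u < m \<and> i < 3}"
    and eq: "vertex_code n p x = vertex_code n p y"
  then obtain u i s u' i' s' where x: "x = Core u i s" "i < 3" and y: "y = Core u' i' s'" "i' < 3"
    by blast
  have "2 * i + of_bool s < (6 :: nat)" "2 * i' + of_bool s' < (6 :: nat)" using x y by auto
  moreover have "(6 * u + (2 * i + of_bool s)) mod 6 = (6 * u' + (2 * i' + of_bool s')) mod 6"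
    using eq by (simp add: x y)
  ultimately have "2 * i + of_bool s = 2 * i' + (of_bool s' :: nat)" by simp
  then have "i = i' \<and> s = s'" by (cases s; cases s'; simp; presburger)
  then show "x = y" using eq by (simp add: x y)
qed

text \<open>Core, apex and private vertices fill three adjacent intervals. Together they form an
  initial segment, as membership in \<open>instances\<close> demands.\<close>

lemma bij_betw_vertex_code:
  assumes "inj_on p P" and "p ` P = {6 * n + of_bool b..<N}" and "6 * n + of_bool b \<le> N"
  defines "U \<equiv> {Core u i s | u i s. u < n \<and> i < 3} \<union> (if b then {Apex} else {}) \<union> Private ` P"
  shows "bij_betw (vertex_code n p) U {..<N}"
proof -
  let ?c = "vertex_code n p"
  have "bij_betw ?c {Core u i s | u i s. u < n \<and> i < 3} {..<6 * n}"
    unfolding bij_betw_def by (intro conjI inj_on_vertex_code_Core vertex_code_Core_image)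
  moreover have "bij_betw ?c (if b then {Apex} else {}) {6 * n..<6 * n + of_bool b}"
    by (auto simp: bij_betw_def)
  ultimately have "bij_betw ?c ({Core u i s | u i s. u < n \<and> i < 3} \<union> (if b then {Apex} else {}))
      ({..<6 * n} \<union> {6 * n..<6 * n + of_bool b})"
    by (rule bij_betw_combine) auto
  moreover have "bij_betw ?c (Private ` P) {6 * n + of_bool b..<N}"
    using assms(1,2) by (auto simp: bij_betw_def inj_on_def image_image)
  ultimately have "bij_betw ?c U ({..<6 * n} \<union> {6 * n..<6 * n + of_bool b} \<union> {6 * n + of_bool b..<N})"
    unfolding U_def by (rule bij_betw_combine) auto
  moreover have "{..<6 * n} \<union> {6 * n..<6 * n + of_bool b} \<union> {6 * n + of_bool b..<N} = {..<N}"
    using assms(3) by auto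
  ultimately show ?thesis by simp
qed

text \<open>Direction, class and sheet: the 12 lifts of one graph edge. Both directions occur, so
  every triangle is also a directed one. The list is a constant, and the program is unrolled over
  it.\<close>

definition specs :: "(bool \<times> nat \<times> bool) list" where
  "specs = List.product [False, True] (List.product [0..<3] [False, True])"

fun spec_label :: "nat \<Rightarrow> nat \<Rightarrow> bool \<times> nat \<times> bool \<Rightarrow> label" where
  "spec_label u v (d, i, s) = (if d then u else v, if d then v else u, i, s)"

definition label_list :: "nat list list \<Rightarrow> label list" where
  "label_list es = concat (map (\<lambda>e. map (spec_label (e ! 0) (e ! 1)) specs) es)"

definition private_classes :: "venn \<Rightarrow> nat" where
  "private_classes V = of_bool (V {1}) + of_bool (V {2}) + of_bool (V {3})"

lemma label_list_simps [simp]: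
  "label_list [] = []" "label_list (e # es) = map (spec_label (e ! 0) (e ! 1)) specs @ label_list es"
  by (simp_all add: label_list_def)

lemma length_label_list: "length (label_list es) = 12 * length es"
  by (induction es) (simp_all add: specs_def)

text \<open>Each class contains four of the lifts, for two directions and two sheets.\<close>

lemma private_count_specs: "private_count V (map (spec_label u v) specs) = 4 * private_classes V"
proof -
  have "[0..<3] = [0, 1, 2 :: nat]" by (simp add: upt_rec)
  then have "private_count V (map (spec_label u v) specs) =
      4 * (of_bool (V {Suc 0}) + of_bool (V {Suc 1}) + of_bool (V {Suc 2}))"
    by (simp add: specs_def)
  moreover have "Suc 0 = 1" "Suc 1 = 2" "Suc 2 = 3" by simp_all
  ultimately show ?thesis by (simp only: private_classes_def)
qed

lemma private_count_label_list: "private_count V (label_list es) = 4 * private_classes V * length es"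
  by (induction es) (simp_all add: private_count_specs)

lemma set_specs: "set specs = UNIV \<times> {..<3} \<times> UNIV"
  unfolding specs_def set_product by (simp only: set_upt lessThan_atLeast0 UNIV_bool) simp

lemma distinct_specs: "distinct specs"
  unfolding specs_def by (intro distinct_product) simp_all

definition arcs :: "nat hypergraph \<Rightarrow> (nat \<times> nat) set" where
  "arcs G = {(u, v). {u, v} \<in> edges G}"

lemma spec_label_image:
  "spec_label u v ` set specs = {(x, y, i, s). {x, y} = {u, v} \<and> i < 3}" if "u \<noteq> v"
proof (intro equalityI subsetI)
  fix l :: label
  assume "l \<in> {(x, y, i, s). {x, y} = {u, v} \<and> i < 3}"
  then obtain x y i s where l: "l = (x, y, i, s)" "{x, y} = {u, v}" "i < 3" by auto
  then have "x = u \<and> y = v \<or> x = v \<and> y = u" by (simp add: doubleton_eq_iff)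
  then have "l = spec_label u v (x = u, i, s)" using that by (elim disjE) (simp_all add: l)
  moreover have "(x = u, i, s) \<in> set specs" using l by (simp add: set_specs)
  ultimately show "l \<in> spec_label u v ` set specs" by (rule image_eqI)
next
  fix l assume "l \<in> spec_label u v ` set specs"
  then obtain d i s where "l = spec_label u v (d, i, s)" "i < 3" by (auto simp: set_specs)
  then show "l \<in> {(x, y, i, s). {x, y} = {u, v} \<and> i < 3}" by (cases d) (simp_all add: insert_commute)
qed

lemma set_label_list:
  assumes "\<forall>e\<in>set es. distinct e \<and> length e = 2"
  shows "set (label_list es) = {(u, v, i, s). {u, v} \<in> set (map set es) \<and> i < 3}"
  using assms
proof (induction es)
  case (Cons e es)
  then obtain u v where e: "e = [u, v]" "u \<noteq> v"
    by (auto simp: length_Suc_conv numeral_2_eq_2)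
  have "set (label_list (e # es)) = spec_label u v ` set specs \<union> set (label_list es)"
    by (simp add: label_list_simps e)
  then show ?case using Cons e by (auto simp: spec_label_image)
qed (simp add: label_list_simps)

lemma distinct_label_list:
  assumes "\<forall>e\<in>set es. distinct e \<and> length e = 2" "distinct (map set es)"
  shows "distinct (label_list es)"
  using assms
proof (induction es)
  case (Cons e es)
  then obtain u v where e: "e = [u, v]" "u \<noteq> v"
    by (auto simp: length_Suc_conv numeral_2_eq_2)
  have "inj (spec_label u v)" using e(2) by (auto simp: inj_def split: if_splits)
  then have "distinct (map (spec_label u v) specs)"
    by (simp add: distinct_map distinct_specs inj_on_subset[OF _ subset_UNIV])
  moreover have "set (map (spec_label u v) specs) \<inter> set (label_list es) = {}"
  proof -
    define S where "S = set (map set es)"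
    have "{u, v} \<notin> S" using Cons.prems(2) by (simp add: e S_def)
    moreover have "set (label_list es) = {(x, y, i, s). {x, y} \<in> S \<and> i < 3}"
      using Cons.prems(1) unfolding S_def by (intro set_label_list) simp
    ultimately show ?thesis
      unfolding set_map[of "spec_label u v"] spec_label_image[OF e(2)] by auto
  qed
  ultimately show ?case using Cons by (simp add: label_list_simps e)
qed (simp add: label_list_simps)

section \<open>The covers as encoded hypergraphs\<close>

definition cover_lists :: "venn \<Rightarrow> bool \<Rightarrow> nat \<Rightarrow> nat list list \<Rightarrow> nat list list" where
  "cover_lists V \<sigma> n es = edge_lists V \<sigma> n (label_list es) (6 * n + of_bool (V {1, 2, 3}))"

text \<open>The number of vertices in closed form. An encoding begins with it, so the program must
  know it before it has visited any edge.\<close>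

definition cover_order :: "venn \<Rightarrow> nat \<Rightarrow> nat \<Rightarrow> nat" where
  "cover_order V n m = 6 * n + of_bool (V {1, 2, 3}) + 4 * private_classes V * m"

definition cover_hypergraph :: "venn \<Rightarrow> bool \<Rightarrow> nat \<Rightarrow> nat list list \<Rightarrow> nat hypergraph" where
  "cover_hypergraph V \<sigma> n es =
     \<lparr>verts = {..<cover_order V n (length es)}, edges = set (map set (cover_lists V \<sigma> n es))\<rparr>"

definition cover_encoding :: "venn \<Rightarrow> bool \<Rightarrow> nat \<Rightarrow> nat list list \<Rightarrow> nat list" where
  "cover_encoding V \<sigma> n es = cover_order V n (length es) # 12 * length es #
     concat (map (\<lambda>e. length e # e) (cover_lists V \<sigma> n es))"

text \<open>The numbering may reserve a number for the apex, which lies in an edge only if there are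
  edges at all; hence \<open>nonempty\<close>.\<close>

locale graph_encoding =
  fixes G :: "nat hypergraph" and n :: nat and es :: "nat list list"
  assumes G: "hypergraph G" "verts G = {..<n}" "uniform 2 G"
    and es: "distinct (map set es)" "\<forall>e\<in>set es. distinct e" "set (map set es) = edges G"
    and nonempty: "es \<noteq> []"
begin

lemma es_pairs: "\<forall>e\<in>set es. distinct e \<and> length e = 2"
proof
  fix e assume "e \<in> set es"
  then have "card (set e) = 2" "distinct e"
    using G(3) es(2,3) unfolding uniform_def by (metis image_eqI set_map, blast)
  then show "distinct e \<and> length e = 2" using distinct_card by metis
qed

lemma set_labels: "set (label_list es) = labels (arcs G)"
  unfolding set_label_list[OF es_pairs] es(3) labels_def arcs_def by simp

lemma arcs_less: "(u, v) \<in> arcs G \<Longrightarrow> u < n \<and> v < n"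
  using G(1,2) unfolding hypergraph_def arcs_def by auto

lemma arcs_irrefl: "(x, x) \<notin> arcs G"
  using G(3) unfolding uniform_def arcs_def by force

lemma labels_bound: "(u, v, i, s) \<in> set (label_list es) \<Longrightarrow> u < n \<and> v < n \<and> i < 3"
  using arcs_less by (auto simp: set_labels labels_def)

text \<open>\<open>vertex_code n p\<close> is an isomorphism from the abstract cover onto the
  hypergraph that is written down. It is onto the initial segment because no vertex of
  \<open>G\<close> is isolated: each of its six copies is the tail of some lifted arc.\<close>

lemma cover_representation:
  obtains p where
    "map set (cover_lists V \<sigma> n es) = map (\<lambda>l. vertex_code n p ` cover_edge V \<sigma> l) (label_list es)"
    "inj_on (vertex_code n p) (\<Union>(cover_edge V \<sigma> ` labels (arcs G)))"
    "vertex_code n p ` \<Union>(cover_edge V \<sigma> ` labels (arcs G)) = {..<cover_order V n (length es)}"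
proof -
  define P where "P = {l \<in> set (label_list es). has_private V l}"
  define w where "w = 6 * n + of_bool (V {1, 2, 3})"
  obtain p where p: "inj_on p P" "p ` P = {w..<w + private_count V (label_list es)}"
    "map set (cover_lists V \<sigma> n es) = map (\<lambda>l. vertex_code n p ` cover_edge V \<sigma> l) (label_list es)"
    using edge_lists_cover_edge[OF distinct_label_list[OF es_pairs es(1)], of V w \<sigma> n]
    unfolding cover_lists_def P_def w_def by blast
  define U where "U = {Core u i s | u i s. u < n \<and> i < 3} \<union> (if V {1, 2, 3} then {Apex} else {}) \<union> Private ` P"
  have U: "\<Union>(cover_edge V \<sigma> ` labels (arcs G)) = U"
  proof (intro equalityI subsetI)
    fix x assume "x \<in> \<Union>(cover_edge V \<sigma> ` labels (arcs G))"
    then obtain u v i s where l: "(u, v, i, s) \<in> labels (arcs G)" "x \<in> cover_edge V \<sigma> (u, v, i, s)"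
      by auto
    then show "x \<in> U"
      using labels_bound[of u v i s] unfolding U_def P_def
      by (auto simp: set_labels next_class_def split: if_splits)
  next
    fix x assume x: "x \<in> U"
    have ex_label: "\<exists>v. (u, v, i, s) \<in> labels (arcs G)" if "u < n" "i < 3" for u i s
    proof -
      have "u \<in> verts G" using that G(2) by simp
      then obtain e where e: "e \<in> edges G" "u \<in> e" using G(1) unfolding hypergraph_def by blast
      have "card e = 2" using e G(3) unfolding uniform_def by blast
      then obtain v where "e = {u, v}" using e(2) by (auto simp: card_2_iff)
      then show ?thesis using e(1) that by (auto simp: labels_def arcs_def)
    qed
    have "\<exists>l. l \<in> labels (arcs G)"
      using length_label_list[of es] nonempty unfolding set_labels[symmetric]
      by (cases "label_list es") auto
    then obtain l0 where l0: "l0 \<in> labels (arcs G)" ..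
    consider (core) u i s where "x = Core u i s" "u < n" "i < 3" | (apex) "x = Apex" "V {1, 2, 3}"
      | (priv) l where "x = Private l" "l \<in> P"
      using x unfolding U_def by (auto split: if_splits)
    then show "x \<in> \<Union>(cover_edge V \<sigma> ` labels (arcs G))"
    proof cases
      case core
      then obtain v where "(u, v, i, s) \<in> labels (arcs G)" using ex_label by blast
      then show ?thesis using core by (intro UN_I[of "(u, v, i, s)"]) auto
    next
      case apex
      moreover have "Apex \<in> cover_edge V \<sigma> l0" using apex(2) by (cases l0) simp
      ultimately show ?thesis using l0 by blast
    next
      case priv
      then show ?thesis by (intro UN_I[of l]) (auto simp: P_def set_labels, cases l, auto)
    qed
  qed
  have "bij_betw (vertex_code n p) U {..<cover_order V n (length es)}"
    unfolding U_def
    by (rule bij_betw_vertex_code[OF p(1)])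
      (use p(2) in \<open>simp_all add: w_def cover_order_def private_count_label_list\<close>)
  then show thesis using that[of p] p(3) unfolding U by (simp add: bij_betw_def)
qed

lemma edges_cover_hypergraph:
  assumes "map set (cover_lists V \<sigma> n es) = map (\<lambda>l. vertex_code n p ` cover_edge V \<sigma> l) (label_list es)"
  shows "edges (cover_hypergraph V \<sigma> n es) =
    (`) (vertex_code n p) ` cover_edge V \<sigma> ` labels (arcs G)"
  unfolding cover_hypergraph_def select_convs assms
  by (simp add: set_labels image_image)

lemma finite_arcs: "finite (arcs G)"
  by (rule finite_subset[of _ "{..<n} \<times> {..<n}"]) (use arcs_less in auto)

lemma cover_hypergraph_instance: "cover_hypergraph V \<sigma> n es \<in> instances"
proof -
  let ?H = "cover_hypergraph V \<sigma> n es"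
  obtain p where p:
    "map set (cover_lists V \<sigma> n es) = map (\<lambda>l. vertex_code n p ` cover_edge V \<sigma> l) (label_list es)"
    "vertex_code n p ` \<Union>(cover_edge V \<sigma> ` labels (arcs G)) = {..<cover_order V n (length es)}"
    by (rule cover_representation)
  have verts: "verts ?H = {..<cover_order V n (length es)}" by (simp add: cover_hypergraph_def)
  note edges = edges_cover_hypergraph[OF p(1)]
  have un: "\<Union>(edges ?H) = verts ?H" unfolding edges verts p(2)[symmetric] by blast
  have "e \<noteq> {}" if e: "e \<in> edges ?H" for e
  proof -
    obtain l where "e = vertex_code n p ` cover_edge V \<sigma> l" using e unfolding edges by blast
    then show ?thesis by (cases l) simp
  qed
  then have "hypergraph ?H"
    using un unfolding hypergraph_def by (auto simp: verts)
  then show ?thesis by (simp add: instances_def verts)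
qed

lemma distinct_cover_lists: "distinct (map set (cover_lists V \<sigma> n es))"
proof -
  obtain p where p:
    "map set (cover_lists V \<sigma> n es) = map (\<lambda>l. vertex_code n p ` cover_edge V \<sigma> l) (label_list es)"
    "inj_on (vertex_code n p) (\<Union>(cover_edge V \<sigma> ` labels (arcs G)))"
    by (rule cover_representation)
  have "inj_on ((`) (vertex_code n p) \<circ> cover_edge V \<sigma>) (labels (arcs G))"
    by (intro comp_inj_on inj_on_cover_edge inj_on_image[OF p(2)])
  then show ?thesis
    unfolding p(1) by (simp add: distinct_map distinct_label_list[OF es_pairs es(1)] set_labels comp_def)
qed

lemma cover_lists_wf: "e \<in> set (cover_lists V \<sigma> n es) \<Longrightarrow> distinct e \<and> e \<noteq> [] \<and> length e \<le> 4"
  unfolding cover_lists_def by (rule edge_lists_wf[where n = n and V = V]) (use labels_bound in auto)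

lemma cover_encoding_encodes: "encodes (cover_encoding V \<sigma> n es) (cover_hypergraph V \<sigma> n es)"
  unfolding encodes_def
  by (rule exI[of _ "cover_lists V \<sigma> n es"])
    (use distinct_cover_lists cover_lists_wf in \<open>simp add: cover_encoding_def cover_hypergraph_def
       cover_lists_def[unfolded] length_label_list\<close>)

lemma cover_hypergraph_rank: "hypergraph_rank (cover_hypergraph V \<sigma> n es) \<le> 4"
proof -
  have "card (set e) \<le> 4" if "e \<in> set (cover_lists V \<sigma> n es)" for e
    using cover_lists_wf[OF that] card_length[of e] by linarith
  then show ?thesis
    unfolding hypergraph_rank_def cover_hypergraph_def by (intro Max.boundedI) auto
qed

lemma card_cover_motifs_eq:
  "card (motifs V (cover_hypergraph V \<sigma> n es)) = card (cover_motifs V \<sigma> (arcs G))"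
proof -
  let ?H = "cover_hypergraph V \<sigma> n es" and ?L = "labels (arcs G)"
  obtain p where p:
    "map set (cover_lists V \<sigma> n es) = map (\<lambda>l. vertex_code n p ` cover_edge V \<sigma> l) (label_list es)"
    "inj_on (vertex_code n p) (\<Union>(cover_edge V \<sigma> ` ?L))"
    by (rule cover_representation)
  define h where "h = (`) (vertex_code n p) \<circ> cover_edge V \<sigma>"
  have edges: "edges ?H = h ` ?L"
    by (simp add: edges_cover_hypergraph[OF p(1)] h_def image_comp)
  have inj: "inj_on h ?L"
    unfolding h_def by (intro comp_inj_on inj_on_cover_edge inj_on_image[OF p(2)])
  have sat: "satisfies_venn V (edge_induced ?H (h ` A)) \<longleftrightarrow>
      satisfies_venn V \<lparr>verts = {}, edges = cover_edge V \<sigma> ` A\<rparr>" if "A \<subseteq> ?L" for A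
  proof (rule satisfies_venn_image)
    show "inj_on (vertex_code n p) (\<Union>(edges \<lparr>verts = {}, edges = cover_edge V \<sigma> ` A\<rparr>))"
      by (rule inj_on_subset[OF p(2)]) (use that in auto)
    show "edges (edge_induced ?H (h ` A)) =
        (`) (vertex_code n p) ` edges \<lparr>verts = {}, edges = cover_edge V \<sigma> ` A\<rparr>"
      by (simp add: edge_induced_def h_def image_comp)
  qed
  have "motifs V ?H = (`) h ` cover_motifs V \<sigma> (arcs G)"
  proof (intro equalityI subsetI)
    fix B assume "B \<in> motifs V ?H"
    then have B: "B \<subseteq> h ` ?L" "card B = 3" "satisfies_venn V (edge_induced ?H B)"
      by (auto simp: motifs_def edges)
    then obtain A where A: "A \<subseteq> ?L" "B = h ` A" by (auto simp: subset_image_iff)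
    have "card A = 3" using B(2) A card_image[OF inj_on_subset[OF inj A(1)]] by simp
    then show "B \<in> (`) h ` cover_motifs V \<sigma> (arcs G)"
      using A B(3) sat[OF A(1)] by (auto simp: cover_motifs_def)
  next
    fix B assume "B \<in> (`) h ` cover_motifs V \<sigma> (arcs G)"
    then obtain A where A: "B = h ` A" "A \<subseteq> ?L" "card A = 3"
      "satisfies_venn V \<lparr>verts = {}, edges = cover_edge V \<sigma> ` A\<rparr>"
      by (auto simp: cover_motifs_def)
    then show "B \<in> motifs V ?H"
      using sat[OF A(2)] card_image[OF inj_on_subset[OF inj A(2)]] by (auto simp: motifs_def edges)
  qed
  moreover have "inj_on ((`) h) (cover_motifs V \<sigma> (arcs G))"
  proof -
    have "inj_on ((`) h) (Pow ?L)" using inj by (rule inj_on_image_Pow)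
    then show ?thesis by (rule inj_on_subset) (auto simp: cover_motifs_def)
  qed
  ultimately show ?thesis by (simp add: card_image)
qed

lemma has_triangle_arcs:
  "has_triangle G \<longleftrightarrow> (\<exists>u v w. (u, v) \<in> arcs G \<and> (v, w) \<in> arcs G \<and> (w, u) \<in> arcs G)"
proof -
  have "x \<noteq> y" if "{x, y} \<in> edges G" for x y
    using that arcs_irrefl[of x] by (auto simp: arcs_def)
  then show ?thesis
    unfolding has_triangle_def arcs_def by (auto simp: insert_commute) metis+
qed

lemma motif_counts_differ:
  assumes "\<not> degenerate V"
  shows "card (motifs V (cover_hypergraph V False n es)) \<noteq> card (motifs V (cover_hypergraph V True n es))
    \<longleftrightarrow> has_triangle G"
  unfolding card_cover_motifs_eq has_triangle_arcs
  by (rule cover_motifs_detect_triangle[OF assms finite_arcs])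

text \<open>Counting all sets of edges is crude but sufficient. Comparing two counts is charged by
  their binary lengths, and an exponent linear in the number of edges keeps this linear.\<close>

lemma card_motifs_le: "card (motifs V (cover_hypergraph V \<sigma> n es)) \<le> 2 ^ (12 * length es)"
proof -
  let ?H = "cover_hypergraph V \<sigma> n es"
  have "card (edges ?H) \<le> 12 * length es"
    unfolding cover_hypergraph_def cover_lists_def select_convs
    by (rule order.trans[OF card_length]) (simp add: length_label_list)
  moreover have fin: "finite (edges ?H)" by (simp add: cover_hypergraph_def)
  then have "card (motifs V ?H) \<le> card (Pow (edges ?H))"
    by (intro card_mono) (auto simp: motifs_def)
  ultimately show ?thesis
    using fin by (simp add: card_Pow) (meson order.trans one_le_numeral power_increasing)
qed

end

section \<open>The reduction as a program\<close>

lemma bits_mono: "a \<le> b \<Longrightarrow> bits a \<le> bits b"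
  unfolding bits_def by (simp add: floor_log_le_iff)

lemma bits_pos: "1 \<le> bits n"
  by (simp add: bits_def)

text \<open>An elementary instruction touches at most two numbers, so it costs at most
  \<open>2 * bits Z\<close> while all of them stay below \<open>Z\<close>; \<open>k\<close> counts
  such units. The postcondition may itself be a \<open>runs\<close> statement, which is how programs
  are composed.\<close>

definition runs :: "nat \<Rightarrow> com \<Rightarrow> state \<Rightarrow> nat \<Rightarrow> (state \<Rightarrow> bool) \<Rightarrow> bool" where
  "runs Z P s k Q \<longleftrightarrow> (\<exists>c t. exec P s c t \<and> c \<le> k * (2 * bits Z) \<and> Q t)"

lemma runsI: "exec P s c t \<Longrightarrow> c \<le> k * (2 * bits Z) \<Longrightarrow> Q t \<Longrightarrow> runs Z P s k Q"
  unfolding runs_def by blast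

lemma runs_mono:
  assumes "runs Z P s k Q" "k \<le> k'" "\<And>t. Q t \<Longrightarrow> Q' t"
  shows "runs Z P s k' Q'"
proof -
  have "k * (2 * bits Z) \<le> k' * (2 * bits Z)" using assms(2) by simp
  then show ?thesis using assms(1,3) unfolding runs_def by (meson order.trans)
qed

lemma runs_Const: "n \<le> Z \<Longrightarrow> Q (R(r := n), M) \<Longrightarrow> runs Z (Const r n) (R, M) 1 Q"
  by (rule runsI[OF exec.Const]) (use bits_mono[of n Z] in simp_all)

lemma runs_Arith:
  "R a \<le> Z \<Longrightarrow> R b \<le> Z \<Longrightarrow> Q (R(r := arith_val f (R a) (R b)), M) \<Longrightarrow> runs Z (Arith f r a b) (R, M) 1 Q"
  by (rule runsI[OF exec.Arith]) (use bits_mono[of "R a" Z] bits_mono[of "R b" Z] in simp_all)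

lemma runs_Load:
  "R a \<le> Z \<Longrightarrow> M b (R a) \<le> Z \<Longrightarrow> Q (R(r := M b (R a)), M) \<Longrightarrow> runs Z (Load r b a) (R, M) 1 Q"
  by (rule runsI[OF exec.Load]) (use bits_mono[of "R a" Z] bits_mono[of "M b (R a)" Z] in simp_all)

lemma runs_Store:
  "R a \<le> Z \<Longrightarrow> R r \<le> Z \<Longrightarrow> Q (R, M(b := (M b)(R a := R r))) \<Longrightarrow> runs Z (Store b a r) (R, M) 1 Q"
  by (rule runsI[OF exec.Store]) (use bits_mono[of "R a" Z] bits_mono[of "R r" Z] in simp_all)

lemma runs_Seq:
  assumes "runs Z P s k (\<lambda>t. runs Z P' t k' Q)"
  shows "runs Z (Seq P P') s (k + k') Q"
proof -
  obtain c t d u where "exec P s c t" "c \<le> k * (2 * bits Z)" "exec P' t d u" "d \<le> k' * (2 * bits Z)" "Q u"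
    using assms unfolding runs_def by blast
  then show ?thesis by (intro runsI[OF exec.Seq]) (auto simp: add_mult_distrib)
qed

lemma runs_While_False: "R r = 0 \<Longrightarrow> Q (R, M) \<Longrightarrow> runs Z (While r P) (R, M) 1 Q"
  by (rule runsI[OF exec.WhileFalse]) (use bits_mono[of 0 Z] in simp_all)

lemma runs_While_True:
  assumes "R r \<noteq> 0" "R r \<le> Z" "runs Z P (R, M) k (\<lambda>t. runs Z (While r P) t k' Q)"
  shows "runs Z (While r P) (R, M) (1 + k + k') Q"
proof -
  obtain c t d u where "exec P (R, M) c t" "c \<le> k * (2 * bits Z)" "exec (While r P) t d u" "d \<le> k' * (2 * bits Z)" "Q u"
    using assms(3) unfolding runs_def by blast
  then show ?thesis using assms(1) bits_mono[OF assms(2)]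
    by (intro runsI[OF exec.WhileTrue]) (auto simp: add_mult_distrib)
qed

fun block :: "com list \<Rightarrow> com" where
  "block [] = Skip"
| "block (c # cs) = Seq c (block cs)"

lemma runs_block_Nil: "Q s \<Longrightarrow> runs Z (block []) s 1 Q"
  unfolding block.simps by (rule runsI[OF exec.Skip]) (use bits_pos[of Z] in simp_all)

lemma runs_block_Cons:
  "runs Z c s k (\<lambda>t. runs Z (block cs) t k' Q) \<Longrightarrow> runs Z (block (c # cs)) s (k + k') Q"
  unfolding block.simps by (rule runs_Seq)

declare block.simps [simp del]

definition cells :: "nat list \<Rightarrow> nat \<Rightarrow> nat" where
  "cells xs a = (if a < length xs then xs ! a else 0)"

lemma cells_append: "(cells xs)(length xs := x) = cells (xs @ [x])"
  by (auto simp: cells_def nth_append)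

lemma runs_Const_block:
  "n \<le> Z \<Longrightarrow> runs Z (block cs) (R(r := n), M) k Q \<Longrightarrow> runs Z (block (Const r n # cs)) (R, M) (Suc k) Q"
  using runs_block_Cons[of Z "Const r n" "(R, M)" 1 cs k Q] runs_Const by simp

lemma runs_Arith_block:
  "R a \<le> Z \<Longrightarrow> R b \<le> Z \<Longrightarrow> runs Z (block cs) (R(r := arith_val f (R a) (R b)), M) k Q \<Longrightarrow>
    runs Z (block (Arith f r a b # cs)) (R, M) (Suc k) Q"
  using runs_block_Cons[of Z "Arith f r a b" "(R, M)" 1 cs k Q] runs_Arith by simp

lemma runs_Load_block:
  "R a \<le> Z \<Longrightarrow> M b (R a) \<le> Z \<Longrightarrow> runs Z (block cs) (R(r := M b (R a)), M) k Q \<Longrightarrow>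
    runs Z (block (Load r b a # cs)) (R, M) (Suc k) Q"
  using runs_block_Cons[of Z "Load r b a" "(R, M)" 1 cs k Q] runs_Load by simp

lemma runs_Store_block:
  "R a \<le> Z \<Longrightarrow> R r \<le> Z \<Longrightarrow> runs Z (block cs) (R, M(b := (M b)(R a := R r))) k Q \<Longrightarrow>
    runs Z (block (Store b a r # cs)) (R, M) (Suc k) Q"
  using runs_block_Cons[of Z "Store b a r" "(R, M)" 1 cs k Q] runs_Store by simp

text \<open>Register 2 holds the next free address of the output bank \<open>b\<close>, register 8 holds 1,
  register 4 the next private vertex, registers 5, 6, 10 hold \<open>6 * u\<close>, \<open>6 * v\<close>, \<open>6 * n\<close>,
  register 1 the reading position and register 3 the number of remaining edges.\<close>

definition writing :: "nat \<Rightarrow> nat \<Rightarrow> nat \<Rightarrow> nat \<Rightarrow> nat \<Rightarrow> nat \<Rightarrow> state \<Rightarrow> nat list \<Rightarrow> nat \<Rightarrow> state \<Rightarrow> bool" where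
  "writing b n u v p k s0 ys w s \<longleftrightarrow>
     fst s 8 = 1 \<and> fst s 2 = length ys \<and> fst s 4 = w \<and> fst s 5 = 6 * u \<and> fst s 6 = 6 * v \<and>
     fst s 10 = 6 * n \<and> fst s 1 = p \<and> fst s 3 = k \<and>
     snd s = (snd s0)(b := cells ys) \<and> (\<forall>r. r = 0 \<or> 10 < r \<longrightarrow> fst s r = fst s0 r)"

section \<open>Writing the hyperedges\<close>

definition emit :: "nat \<Rightarrow> nat \<Rightarrow> com list" where
  "emit b r = [Store b 2 r, Arith Add 2 2 8]"

lemma runs_emit:
  assumes "writing b n u v p k0 s0 ys w s" and "fst s r = x" and "x \<le> Z" "length ys < Z"
    and "\<And>t. writing b n u v p k0 s0 (ys @ [x]) w t \<Longrightarrow> runs Z (block cs) t k Q"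
  shows "runs Z (block (emit b r @ cs)) s (k + 2) Q"
proof -
  obtain R M where s: "s = (R, M)" by (cases s)
  have "runs Z (block (Store b 2 r # Arith Add 2 2 8 # cs)) (R, M) (Suc (Suc k)) Q"
    by (rule runs_Store_block; (rule runs_Arith_block)?)
      (use assms(1-4) in \<open>simp_all add: s writing_def\<close>, rule assms(5),
        use assms(1,2) cells_append[of ys x] in \<open>simp add: s writing_def\<close>)
  then show ?thesis by (simp add: s emit_def)
qed

lemma runs_Const_writing:
  assumes "writing b n u v p k0 s0 ys w s" and "x \<le> Z"
    and "\<And>t. writing b n u v p k0 s0 ys w t \<Longrightarrow> fst t 7 = x \<Longrightarrow> runs Z (block cs) t k Q"
  shows "runs Z (block (Const 7 x # cs)) s (k + 1) Q"
proof -
  obtain R M where s: "s = (R, M)" by (cases s)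
  have "writing b n u v p k0 s0 ys w (R(7 := x), M)"
    using assms(1) by (simp add: s writing_def)
  then show ?thesis using assms(2,3) by (simp add: s runs_Const_block)
qed

lemma runs_Add_writing:
  assumes "writing b n u v p k0 s0 ys w s" and "fst s r = x" "fst s 7 = y" "x \<le> Z" "y \<le> Z"
    and "\<And>t. writing b n u v p k0 s0 ys w t \<Longrightarrow> fst t 7 = x + y \<Longrightarrow> runs Z (block cs) t k Q"
  shows "runs Z (block (Arith Add 7 r 7 # cs)) s (k + 1) Q"
proof -
  obtain R M where s: "s = (R, M)" by (cases s)
  have "writing b n u v p k0 s0 ys w (R(7 := x + y), M)"
    using assms(1) by (simp add: s writing_def)
  then have "runs Z (block cs) (R(7 := x + y), M) k Q" using assms(6) by simp
  then show ?thesis using assms(2-5) by (simp add: s runs_Arith_block)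
qed

lemma runs_emit_const:
  assumes "writing b n u v p k0 s0 ys w s" and "x \<le> Z" "length ys < Z"
    and "\<And>t. writing b n u v p k0 s0 (ys @ [x]) w t \<Longrightarrow> runs Z (block cs) t k Q"
  shows "runs Z (block (Const 7 x # emit b 7 @ cs)) s (k + 3) Q"
proof -
  have "runs Z (block (Const 7 x # emit b 7 @ cs)) s (k + 2 + 1) Q"
    by (rule runs_Const_writing[OF assms(1,2)], rule runs_emit) (use assms in auto)
  then show ?thesis by (simp add: numeral_eq_Suc)
qed

lemma runs_emit_sum:
  assumes "writing b n u v p k0 s0 ys w s" and "x + y \<le> Z" "length ys < Z"
    and "\<And>t. writing b n u v p k0 s0 ys w t \<Longrightarrow> fst t r = x"
    and "\<And>t. writing b n u v p k0 s0 (ys @ [x + y]) w t \<Longrightarrow> runs Z (block cs) t k Q"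
  shows "runs Z (block (Const 7 y # Arith Add 7 r 7 # emit b 7 @ cs)) s (k + 4) Q"
proof -
  have "runs Z (block (Const 7 y # Arith Add 7 r 7 # emit b 7 @ cs)) s (k + 2 + 1 + 1) Q"
  proof (rule runs_Const_writing[OF assms(1)])
    fix t assume t: "writing b n u v p k0 s0 ys w t" "fst t 7 = y"
    show "runs Z (block (Arith Add 7 r 7 # emit b 7 @ cs)) t (k + 2 + 1) Q"
    proof (rule runs_Add_writing[OF t(1) assms(4)[OF t(1)] t(2)])
      fix t assume t: "writing b n u v p k0 s0 ys w t" "fst t 7 = x + y"
      show "runs Z (block (emit b 7 @ cs)) t (k + 2) Q"
        by (rule runs_emit[OF t assms(2,3,5)])
    qed (use assms(2) in simp_all)
  qed (use assms(2) in simp)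
  then show ?thesis by (simp add: numeral_eq_Suc)
qed

lemma runs_next_private:
  assumes "writing b n u v p k0 s0 ys w s" and "w < Z"
    and "\<And>t. writing b n u v p k0 s0 ys (Suc w) t \<Longrightarrow> runs Z (block cs) t k Q"
  shows "runs Z (block (Arith Add 4 4 8 # cs)) s (k + 1) Q"
proof -
  obtain R M where s: "s = (R, M)" by (cases s)
  have "writing b n u v p k0 s0 ys (Suc w) (R(4 := Suc w), M)"
    using assms(1) by (simp add: s writing_def)
  then have "runs Z (block cs) (R(4 := Suc w), M) k Q" by (rule assms(3))
  then show ?thesis using assms(1,2) by (simp add: s runs_Arith_block writing_def)
qed

text \<open>\<open>V\<close>, \<sigma>, \<open>d\<close>, \<open>i\<close> and \<open>s\<close> are
  known when the program is generated. All case distinctions are settled then, and the code is a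
  straight line.\<close>

definition emit_edge :: "venn \<Rightarrow> bool \<Rightarrow> nat \<Rightarrow> bool \<times> nat \<times> bool \<Rightarrow> com list" where
  "emit_edge V \<sigma> b = (\<lambda>(d, i, s).
     Const 7 (2 + of_bool (V {1, 2, 3}) + of_bool (V {Suc i})) # emit b 7 @
     Const 7 (2 * i + of_bool s) # Arith Add 7 (if d then 5 else 6) 7 # emit b 7 @
     Const 7 (2 * next_class i + of_bool (s \<noteq> (\<sigma> \<and> i = 2))) # Arith Add 7 (if d then 6 else 5) 7 # emit b 7 @
     (if V {1, 2, 3} then emit b 10 else []) @
     (if V {Suc i} then emit b 4 @ [Arith Add 4 4 8] else []))"

lemma length_edge_list:
  "length (edge_list V \<sigma> n l w) = 2 + of_bool (V {1, 2, 3}) + of_bool (has_private V l)"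
  by (cases l) (simp add: edge_list_def)

text \<open>The 16 units are three for the length word, four for each core vertex, two for the apex
  and three for the private vertex. At most five words are written, hence
  \<open>length ys + 5\<close>.\<close>

lemma runs_emit_edge:
  assumes wr: "writing b n u v p k0 s0 ys w s"
    and bounds: "length ys + 5 \<le> Z" "w < Z" "6 * n \<le> Z" "u < n" "v < n" "i < 3"
    and cont: "\<And>t. writing b n u v p k0 s0
        (ys @ length (edge_list V \<sigma> n (spec_label u v (d, i, s')) w) # edge_list V \<sigma> n (spec_label u v (d, i, s')) w)
        (w + of_bool (V {Suc i})) t \<Longrightarrow> runs Z (block cs) t k Q"
  shows "runs Z (block (emit_edge V \<sigma> b (d, i, s') @ cs)) s (k + 16) Q"
proof -
  define a where "a = 2 * i + of_bool s'"
  define a' where "a' = 2 * next_class i + of_bool (s' \<noteq> (\<sigma> \<and> i = 2))"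
  have a: "a < 6" "a' < 6" using \<open>i < 3\<close> by (auto simp: a_def a'_def next_class_def)
  define x where "x = (if d then u else v)"
  define y where "y = (if d then v else u)"
  have xy: "x < n" "y < n" using bounds by (auto simp: x_def y_def)
  define ell where "ell = 2 + of_bool (V {1, 2, 3}) + (of_bool (V {Suc i}) :: nat)"
  have ell: "ell \<le> 4" by (simp add: ell_def)
  define zs where "zs = ys @ [ell] @ [6 * x + a] @ [6 * y + a']"
  have zs: "length zs = length ys + 3" by (simp add: zs_def)
  define apex where "apex = (if V {1, 2, 3} then [6 * n] else [])"
  have emission: "ys @ length (edge_list V \<sigma> n (spec_label u v (d, i, s')) w) # edge_list V \<sigma> n (spec_label u v (d, i, s')) w =
      zs @ apex @ (if V {Suc i} then [w] else [])"
    unfolding length_edge_list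
    unfolding zs_def apex_def edge_list_def spec_label.simps prod.case a_def[symmetric] a'_def[symmetric]
      x_def[symmetric] y_def[symmetric]
    by (simp add: ell_def)
  note cont = cont[unfolded emission]
  have priv: "runs Z (block ((if V {Suc i} then emit b 4 @ [Arith Add 4 4 8] else []) @ cs)) t (k + 3) Q"
    if t: "writing b n u v p k0 s0 (zs @ apex) w t" for t
  proof (cases "V {Suc i}")
    case True
    have "runs Z (block (emit b 4 @ Arith Add 4 4 8 # cs)) t (k + 1 + 2) Q"
      by (rule runs_emit[OF t, of _ w], use t in \<open>simp add: writing_def\<close>, use bounds in simp,
          use bounds zs in \<open>simp add: apex_def\<close>, rule runs_next_private, assumption)
        (use bounds cont True in auto)
    then show ?thesis using True by (simp add: numeral_eq_Suc)
  next
    case False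
    then have "runs Z (block cs) t k Q" using cont t by simp
    then show ?thesis using False by (auto elim: runs_mono)
  qed
  have tail: "runs Z (block ((if V {1, 2, 3} then emit b 10 else []) @
      (if V {Suc i} then emit b 4 @ [Arith Add 4 4 8] else []) @ cs)) t (k + 5) Q"
    if t: "writing b n u v p k0 s0 zs w t" for t
  proof (cases "V {1, 2, 3}")
    case True
    have "runs Z (block (emit b 10 @ (if V {Suc i} then emit b 4 @ [Arith Add 4 4 8] else []) @ cs)) t (k + 3 + 2) Q"
      by (rule runs_emit[OF t, of _ "6 * n"], use t in \<open>simp add: writing_def\<close>)
        (use bounds zs priv True in \<open>simp_all add: apex_def\<close>)
    then show ?thesis using True by (simp add: numeral_eq_Suc)
  next
    case False
    then have "runs Z (block ((if V {Suc i} then emit b 4 @ [Arith Add 4 4 8] else []) @ cs)) t (k + 3) Q"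
      using t False by (intro priv) (simp add: apex_def)
    then have "runs Z (block ((if V {Suc i} then emit b 4 @ [Arith Add 4 4 8] else []) @ cs)) t (k + 5) Q"
      by (rule runs_mono) simp_all
    then show ?thesis using False by simp
  qed
  have "runs Z (block (Const 7 ell # emit b 7 @ Const 7 a # Arith Add 7 (if d then 5 else 6) 7 # emit b 7 @
      Const 7 a' # Arith Add 7 (if d then 6 else 5) 7 # emit b 7 @ (if V {1, 2, 3} then emit b 10 else []) @
      (if V {Suc i} then emit b 4 @ [Arith Add 4 4 8] else []) @ cs)) s (k + 5 + 4 + 4 + 3) Q"
  proof (rule runs_emit_const[OF wr])
    fix t assume t: "writing b n u v p k0 s0 (ys @ [ell]) w t"
    show "runs Z (block (Const 7 a # Arith Add 7 (if d then 5 else 6) 7 # emit b 7 @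
      Const 7 a' # Arith Add 7 (if d then 6 else 5) 7 # emit b 7 @ (if V {1, 2, 3} then emit b 10 else []) @
      (if V {Suc i} then emit b 4 @ [Arith Add 4 4 8] else []) @ cs)) t (k + 5 + 4 + 4) Q"
    proof (rule runs_emit_sum[OF t, of "6 * x"])
      fix t assume t: "writing b n u v p k0 s0 ((ys @ [ell]) @ [6 * x + a]) w t"
      show "runs Z (block (Const 7 a' # Arith Add 7 (if d then 6 else 5) 7 # emit b 7 @
        (if V {1, 2, 3} then emit b 10 else []) @
        (if V {Suc i} then emit b 4 @ [Arith Add 4 4 8] else []) @ cs)) t (k + 5 + 4) Q"
        by (rule runs_emit_sum[OF t, of "6 * y"])
          (use bounds a xy tail in \<open>auto simp: zs_def writing_def y_def\<close>)
    qed (use bounds a xy in \<open>auto simp: writing_def x_def\<close>)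
  qed (use bounds a xy ell in auto)
  then show ?thesis
    by (simp add: emit_edge_def ell_def a_def a'_def numeral_eq_Suc)
qed

abbreviation flatten :: "nat list list \<Rightarrow> nat list" where
  "flatten es \<equiv> concat (map (\<lambda>e. length e # e) es)"

lemma length_flatten_edge_lists: "length (flatten (edge_lists V \<sigma> n ls w)) \<le> 5 * length ls"
proof (induction ls arbitrary: w)
  case (Cons l ls)
  have "length (edge_list V \<sigma> n l w) \<le> 4" by (simp add: length_edge_list)
  with Cons[of "w + of_bool (has_private V l)"] show ?case by simp
qed simp

lemma runs_emit_edges:
  assumes "writing b n u v p k0 s0 ys w s"
    and "length ys + 5 * length sps \<le> Z" "w + length sps \<le> Z" "6 * n \<le> Z" "u < n" "v < n"
    and "\<forall>(d, i, s')\<in>set sps. i < 3"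
    and "\<And>t. writing b n u v p k0 s0 (ys @ flatten (edge_lists V \<sigma> n (map (spec_label u v) sps) w))
        (w + private_count V (map (spec_label u v) sps)) t \<Longrightarrow> runs Z (block cs) t k Q"
  shows "runs Z (block (concat (map (emit_edge V \<sigma> b) sps) @ cs)) s (k + 16 * length sps) Q"
  using assms
proof (induction sps arbitrary: ys w s)
  case Nil
  then show ?case by simp
next
  case (Cons sp sps)
  obtain d i s' where sp: "sp = (d, i, s')" by (cases sp)
  let ?l = "spec_label u v (d, i, s')"
  let ?e = "edge_list V \<sigma> n ?l w"
  have hp: "has_private V ?l = V {Suc i}" by simp
  have "runs Z (block (emit_edge V \<sigma> b (d, i, s') @ concat (map (emit_edge V \<sigma> b) sps) @ cs)) s
      ((k + 16 * length sps) + 16) Q"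
  proof (rule runs_emit_edge[OF Cons.prems(1)])
    fix t assume t: "writing b n u v p k0 s0 (ys @ length ?e # ?e) (w + of_bool (V {Suc i})) t"
    show "runs Z (block (concat (map (emit_edge V \<sigma> b) sps) @ cs)) t (k + 16 * length sps) Q"
    proof (rule Cons.IH[OF t])
      show "length (ys @ length ?e # ?e) + 5 * length sps \<le> Z"
        using Cons.prems(2) by (simp add: length_edge_list)
      show "w + of_bool (V {Suc i}) + length sps \<le> Z" using Cons.prems(3) by simp
      fix t
      assume "writing b n u v p k0 s0
        ((ys @ length ?e # ?e) @ flatten (edge_lists V \<sigma> n (map (spec_label u v) sps) (w + of_bool (V {Suc i}))))
        (w + of_bool (V {Suc i}) + private_count V (map (spec_label u v) sps)) t"
      then show "runs Z (block cs) t k Q"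
        by (intro Cons.prems(8)) (simp add: sp hp add.assoc del: spec_label.simps)
    qed (use Cons.prems in auto)
  qed (use Cons.prems sp in auto)
  then show ?case by (simp add: sp ac_simps)
qed

text \<open>The first increment steps over the length word, which is 2 in a graph. The end points
  are multiplied by 6 once, so each core code then takes one addition.\<close>

definition read_edge :: "com list" where
  "read_edge = [Arith Add 1 1 8, Load 5 0 1, Const 7 6, Arith Mul 5 5 7, Arith Add 1 1 8, Load 6 0 1,
     Arith Mul 6 6 7, Arith Add 1 1 8]"

lemma runs_read_edge:
  assumes "writing b n u' v' (length pre) k0 s0 ys w s" and "b \<noteq> 0"
    and "snd s0 0 = cells (pre @ [2, u, v] @ post)"
    and "length pre + 3 \<le> Z" "6 \<le> Z" "6 * u \<le> Z" "6 * v \<le> Z"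
    and "\<And>t. writing b n u v (length pre + 3) k0 s0 ys w t \<Longrightarrow> runs Z (block cs) t k Q"
  shows "runs Z (block (read_edge @ cs)) s (k + 8) Q"
proof -
  obtain R M where s: "s = (R, M)" by (cases s)
  have M: "M 0 (Suc (length pre)) = u" "M 0 (Suc (Suc (length pre))) = v"
    using assms(1-3) by (simp_all add: s writing_def cells_def nth_append)
  have R: "R 8 = 1" "R 1 = length pre" using assms(1) by (simp_all add: s writing_def)
  define R' where "R' = R(1 := Suc (Suc (Suc (length pre))), 5 := u * 6, 6 := v * 6, 7 := 6)"
  have wr: "writing b n u v (length pre + 3) k0 s0 ys w (R', M)"
    using assms(1) by (simp add: s writing_def R'_def)
  have R'_eq: "R(1 := Suc (length pre), 5 := u, 7 := 6, 5 := u * 6, 1 := Suc (Suc (length pre)), 6 := v,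
      6 := v * 6, 1 := Suc (Suc (Suc (length pre)))) = R'"
    by (auto simp: R'_def fun_eq_iff)
  have "runs Z (block cs) (R(1 := Suc (length pre), 5 := u, 7 := 6, 5 := u * 6, 1 := Suc (Suc (length pre)), 6 := v,
      6 := v * 6, 1 := Suc (Suc (Suc (length pre)))), M) k Q"
    unfolding R'_eq by (rule assms(8)[OF wr])
  then have "runs Z (block (read_edge @ cs)) (R, M) (Suc (Suc (Suc (Suc (Suc (Suc (Suc (Suc k)))))))) Q"
    unfolding read_edge_def append_Cons append_Nil using assms(4-7) M R
    by (intro runs_Arith_block runs_Load_block runs_Const_block) simp_all
  then show ?thesis by (simp add: s numeral_eq_Suc)
qed

definition loop_body :: "venn \<Rightarrow> bool \<Rightarrow> nat \<Rightarrow> com" where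
  "loop_body V \<sigma> b = block (read_edge @ concat (map (emit_edge V \<sigma> b) specs) @ [Arith Sub 3 3 8])"

lemma length_specs: "length specs = 12"
  by (simp add: specs_def)

text \<open>The premises are the loop invariant: \<open>pre\<close> has been read and
  \<open>ys\<close> has been written. A round takes one unit for the test, 8 for reading,
  \<open>12 * 16\<close> for writing and 2 for the decrement and the end of the block, that is 203,
  rounded up to 210. It writes at most \<open>12 * 5 = 60\<close> words and uses at most 12 private
  names.\<close>

lemma runs_loop:
  assumes "writing b n u' v' (length pre) (length es) s0 ys w s" and "b \<noteq> 0"
    and "snd s0 0 = cells (pre @ flatten es)" and "\<forall>e\<in>set es. length e = 2 \<and> set e \<subseteq> {..<n}"
    and "length pre + 3 * length es \<le> Z" "length ys + 60 * length es \<le> Z" "w + 12 * length es \<le> Z"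
      "6 * n \<le> Z" "0 < Z"
  shows "runs Z (While 3 (loop_body V \<sigma> b)) s (210 * length es + 1)
    (\<lambda>t. \<exists>u v p. writing b n u v p 0 s0 (ys @ flatten (edge_lists V \<sigma> n (label_list es) w))
      (w + private_count V (label_list es)) t)"
  using assms
proof (induction es arbitrary: u' v' pre ys w s)
  case Nil
  then obtain R M where s: "s = (R, M)" "R 3 = 0" by (cases s) (auto simp: writing_def)
  have "\<exists>u v p. writing b n u v p 0 s0 (ys @ flatten (edge_lists V \<sigma> n (label_list []) w))
      (w + private_count V (label_list [])) (R, M)"
    using Nil s(1) by auto
  from runs_While_False[where Q = "\<lambda>t. \<exists>u v p. writing b n u v p 0 s0
      (ys @ flatten (edge_lists V \<sigma> n (label_list []) w)) (w + private_count V (label_list [])) t", OF s(2) this]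
  show ?case unfolding s(1) by simp
next
  case (Cons e es)
  then obtain u v where e: "e = [u, v]" "u < n" "v < n"
    by (auto simp: length_Suc_conv numeral_2_eq_2)
  let ?ls = "map (spec_label u v) specs"
  let ?ys = "ys @ flatten (edge_lists V \<sigma> n ?ls w)" and ?w = "w + private_count V ?ls"
  let ?Q = "\<lambda>t. \<exists>u v p. writing b n u v p 0 s0 (ys @ flatten (edge_lists V \<sigma> n (label_list (e # es)) w))
      (w + private_count V (label_list (e # es))) t"
  have flatten: "flatten (e # es) = [2, u, v] @ flatten es" by (simp add: e)
  have input: "snd s0 0 = cells (pre @ [2, u, v] @ flatten es)"
    using Cons.prems(3) unfolding flatten .
  obtain R M where s: "s = (R, M)" "R 3 = Suc (length es)"
    using Cons.prems(1) by (cases s) (auto simp: writing_def)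
  have len: "length (flatten (edge_lists V \<sigma> n ?ls w)) \<le> 60"
    using length_flatten_edge_lists[of V \<sigma> n ?ls w] by (simp add: length_specs)
  have cnt: "private_count V ?ls \<le> 12"
    unfolding private_count_def by (rule order.trans[OF length_filter_le]) (simp add: length_specs)
  have next_iteration: "runs Z (While 3 (loop_body V \<sigma> b)) t (210 * length es + 1) ?Q"
    if t: "writing b n u v (length pre + 3) (length es) s0 ?ys ?w t" for t
  proof -
    have "runs Z (While 3 (loop_body V \<sigma> b)) t (210 * length es + 1)
      (\<lambda>t. \<exists>u v p. writing b n u v p 0 s0 (?ys @ flatten (edge_lists V \<sigma> n (label_list es) ?w))
        (?w + private_count V (label_list es)) t)"
    proof (rule Cons.IH[of u v "pre @ [2, u, v]" ?ys ?w t])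
      show "writing b n u v (length (pre @ [2, u, v])) (length es) s0 ?ys ?w t"
        using t by (simp add: numeral_3_eq_3)
      show "snd s0 0 = cells ((pre @ [2, u, v]) @ flatten es)"
        unfolding append_assoc by (rule input)
    qed (use Cons.prems len cnt in auto)
    then show ?thesis by (simp add: e edge_lists_append add.assoc)
  qed
  have body: "runs Z (block (read_edge @ concat (map (emit_edge V \<sigma> b) specs) @ [Arith Sub 3 3 8])) s
    (2 + 16 * length specs + 8) (\<lambda>t. runs Z (While 3 (loop_body V \<sigma> b)) t (210 * length es + 1) ?Q)"
  proof (rule runs_read_edge[OF Cons.prems(1,2) input])
    fix t assume t: "writing b n u v (length pre + 3) (length (e # es)) s0 ys w t"
    show "runs Z (block (concat (map (emit_edge V \<sigma> b) specs) @ [Arith Sub 3 3 8])) t (2 + 16 * length specs)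
      (\<lambda>t. runs Z (While 3 (loop_body V \<sigma> b)) t (210 * length es + 1) ?Q)"
    proof (rule runs_emit_edges[OF t])
      fix t assume t: "writing b n u v (length pre + 3) (length (e # es)) s0 ?ys ?w t"
      obtain R M where t': "t = (R, M)" by (cases t)
      have R: "R 3 = Suc (length es)" "R 8 = 1" using t by (auto simp: writing_def t')
      have "writing b n u v (length pre + 3) (length es) s0 ?ys ?w (R(3 := length es), M)"
        using t by (simp add: writing_def t')
      from next_iteration[OF this] have "runs Z (block []) (R(3 := length es), M) 1
          (\<lambda>t. runs Z (While 3 (loop_body V \<sigma> b)) t (210 * length es + 1) ?Q)"
        by (rule runs_block_Nil)
      then have "runs Z (block [Arith Sub 3 3 8]) (R, M) (Suc 1)
          (\<lambda>t. runs Z (While 3 (loop_body V \<sigma> b)) t (210 * length es + 1) ?Q)"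
        using Cons.prems(5,9) R by (intro runs_Arith_block) simp_all
      then show "runs Z (block [Arith Sub 3 3 8]) t 2
          (\<lambda>t. runs Z (While 3 (loop_body V \<sigma> b)) t (210 * length es + 1) ?Q)"
        by (simp add: t' numeral_2_eq_2)
    qed (use Cons.prems e in \<open>auto simp: length_specs set_specs\<close>)
  qed (use Cons.prems e in auto)
  note body = body[folded loop_body_def]
  have "runs Z (While 3 (loop_body V \<sigma> b)) s (1 + (2 + 16 * length specs + 8) + (210 * length es + 1)) ?Q"
    unfolding s(1) by (rule runs_While_True) (use s Cons.prems(5) body in auto)
  then show ?case by (rule runs_mono) (auto simp: length_specs)
qed

definition build :: "venn \<Rightarrow> bool \<Rightarrow> nat \<Rightarrow> com" where
  "build V \<sigma> b = block (
     [Const 8 1, Const 2 0, Load 7 0 2, Const 9 6, Arith Mul 10 7 9, Load 3 0 8,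
      Const 9 (of_bool (V {1, 2, 3})), Arith Add 4 10 9, Const 9 (4 * private_classes V), Arith Mul 9 9 3,
      Arith Add 9 4 9, Const 5 0, Const 6 0, Const 1 2] @ emit b 9 @
     [Const 9 12, Arith Mul 9 9 3] @ emit b 9 @ [While 3 (loop_body V \<sigma> b)])"

text \<open>By \<open>n \<le> 2 * length es\<close>, vertex numbers are at most
  \<open>24 * m + 1\<close>, and output addresses at most \<open>2 + 60 * m\<close>. The bound
  \<open>100 * (m + 1)\<close> leaves room for these and for all constants.\<close>

lemma runs_build:
  assumes "snd s 0 = cells (n # length es # flatten es)" and "snd s b = cells []" and "b \<noteq> 0"
    and es: "\<forall>e\<in>set es. length e = 2 \<and> set e \<subseteq> {..<n}"
    and Z: "100 * (length es + 1) \<le> Z" "n \<le> 2 * length es"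
  shows "runs Z (build V \<sigma> b) s (210 * length es + 30)
    (\<lambda>t. snd t = (snd s)(b := cells (cover_encoding V \<sigma> n es)) \<and> (\<forall>r. r = 0 \<or> 10 < r \<longrightarrow> fst t r = fst s r))"
    (is "runs Z _ s _ ?Q")
proof -
  obtain R M where s: "s = (R, M)" by (cases s)
  define m where "m = length es"
  define a :: nat where "a = of_bool (V {1, 2, 3})"
  define w where "w = 6 * n + a"
  define q where "q = 4 * private_classes V"
  define N where "N = w + q * m"
  have N: "N = cover_order V n (length es)"
    by (simp add: N_def w_def a_def q_def m_def cover_order_def)
  have M: "M 0 0 = n" "M 0 1 = m" using assms(1) by (simp_all add: s cells_def m_def)
  have q: "q \<le> 12" by (simp add: q_def private_classes_def)
  then have qm: "q * m \<le> 12 * m" by simp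
  have wa: "a \<le> 1" "w \<le> 6 * n + 1" by (simp_all add: w_def a_def)
  have bounds: "a \<le> Z" "6 \<le> Z" "n \<le> Z" "6 * n \<le> Z" "m \<le> Z" "q \<le> Z" "q * m \<le> Z" "w \<le> Z" "N \<le> Z" "12 \<le> Z" "12 * m \<le> Z" "2 \<le> Z"
    "w + 12 * m \<le> Z" "2 + 60 * m \<le> Z" "2 + 3 * m \<le> Z"
  proof -
    \<comment> \<open>Treating the product as an atom makes the inequalities linear.\<close>
    define r where "r = q * m"
    have "100 * (m + 1) \<le> Z" "n \<le> 2 * m" "r \<le> 12 * m" using Z qm by (simp_all only: m_def r_def)
    then show "a \<le> Z" "6 \<le> Z" "n \<le> Z" "6 * n \<le> Z" "m \<le> Z" "q \<le> Z" "q * m \<le> Z" "w \<le> Z" "N \<le> Z" "12 \<le> Z"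
      "12 * m \<le> Z" "2 \<le> Z" "w + 12 * m \<le> Z" "2 + 60 * m \<le> Z" "2 + 3 * m \<le> Z"
      using q wa unfolding N_def r_def[symmetric] by simp_all
  qed
  let ?loop = "[While 3 (loop_body V \<sigma> b)]"
  have loop: "runs Z (block ?loop) t (210 * m + 2) ?Q"
    if t: "writing b n 0 0 2 m s [N, 12 * m] w t" for t
  proof -
    have "runs Z (While 3 (loop_body V \<sigma> b)) t (210 * length es + 1)
      (\<lambda>t. \<exists>u v p. writing b n u v p 0 s ([N, 12 * m] @ flatten (edge_lists V \<sigma> n (label_list es) w))
        (w + private_count V (label_list es)) t)"
      by (rule runs_loop[of _ _ 0 0 "[n, m]"])
        (use t assms bounds in \<open>auto simp: m_def numeral_2_eq_2\<close>)
    then have "runs Z (While 3 (loop_body V \<sigma> b)) t (210 * length es + 1) (\<lambda>t. runs Z (block []) t 1 ?Q)"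
      by (rule runs_mono)
        (auto simp: writing_def cover_encoding_def cover_lists_def N w_def a_def m_def intro!: runs_block_Nil[unfolded One_nat_def])
    then have "runs Z (block ?loop) t (210 * length es + 1 + 1) ?Q" by (rule runs_block_Cons)
    then show ?thesis by (simp add: m_def)
  qed
  have second: "runs Z (block ([Const 9 12, Arith Mul 9 9 3] @ emit b 9 @ ?loop)) t (210 * m + 6) ?Q"
    if t: "writing b n 0 0 2 m s [N] w t" for t
  proof -
    obtain R M where t': "t = (R, M)" by (cases t)
    have t2: "writing b n 0 0 2 m s [N] w (R(9 := 12 * m), M)"
      using t by (simp add: writing_def t')
    have "runs Z (block (emit b 9 @ ?loop)) (R(9 := 12 * m), M) (210 * m + 2 + 2) ?Q"
      by (rule runs_emit[OF t2, of _ "12 * m"]) (use loop bounds in simp_all)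
    then have "runs Z (block (emit b 9 @ ?loop)) (R(9 := 12, 9 := 12 * m), M) (210 * m + 2 + 2) ?Q" by simp
    then have "runs Z (block (Const 9 12 # Arith Mul 9 9 3 # emit b 9 @ ?loop)) (R, M) (Suc (Suc (210 * m + 2 + 2))) ?Q"
      using bounds t by (intro runs_Const_block runs_Arith_block) (simp_all add: writing_def t')
    then show ?thesis by (simp add: t' numeral_eq_Suc)
  qed
  let ?R = "R(8 := 1, 2 := 0, 7 := n, 9 := 6, 10 := n * 6, 3 := m, 9 := a, 4 := n * 6 + a, 9 := q, 9 := q * m,
      9 := n * 6 + a + q * m, 5 := 0, 6 := 0, 1 := 2)"
  have "writing b n 0 0 2 m s [] w (?R, M)"
    using fun_upd_idem[of M b "cells []"] assms(2) by (simp add: writing_def s w_def)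
  then have "runs Z (block (emit b 9 @ [Const 9 12, Arith Mul 9 9 3] @ emit b 9 @ ?loop)) (?R, M) (210 * m + 6 + 2) ?Q"
    by (rule runs_emit[of _ _ _ _ _ _ _ _ _ _ _ N]) (use second bounds in \<open>simp_all add: N_def w_def\<close>)
  then have "runs Z (build V \<sigma> b) (R, M) (Suc (Suc (Suc (Suc (Suc (Suc (Suc (Suc (Suc (Suc (Suc (Suc (Suc (Suc (210 * m + 6 + 2))))))))))))))) ?Q"
    unfolding build_def append_Cons append_Nil a_def[symmetric] q_def[symmetric]
    using bounds M
    by (intro runs_Const_block runs_Arith_block runs_Load_block) (simp_all add: w_def N_def mult.commute[of n 6])
  then show ?thesis unfolding s by (rule runs_mono) (simp_all add: m_def s)
qed

section \<open>Renaming registers and banks\<close>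

fun rename_com :: "(nat \<Rightarrow> nat) \<Rightarrow> (nat \<Rightarrow> nat) \<Rightarrow> com \<Rightarrow> com" where
  "rename_com f g Skip = Skip"
| "rename_com f g (Const r n) = Const (f r) n"
| "rename_com f g (Arith h r a b) = Arith h (f r) (f a) (f b)"
| "rename_com f g (Load r b a) = Load (f r) (g b) (f a)"
| "rename_com f g (Store b a r) = Store (g b) (f a) (f r)"
| "rename_com f g (Seq P Q) = Seq (rename_com f g P) (rename_com f g Q)"
| "rename_com f g (If r P Q) = If (f r) (rename_com f g P) (rename_com f g Q)"
| "rename_com f g (While r P) = While (f r) (rename_com f g P)"

text \<open>\<open>s'\<close> carries \<open>s\<close> on the ranges of \<open>f\<close> and
  \<open>g\<close> and agrees with the frame \<open>s0\<close> elsewhere. The frame protects the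
  second input during the first run and the first result during the second.\<close>

definition renamed_state :: "(nat \<Rightarrow> nat) \<Rightarrow> (nat \<Rightarrow> nat) \<Rightarrow> state \<Rightarrow> state \<Rightarrow> state \<Rightarrow> bool" where
  "renamed_state f g s s0 s' \<longleftrightarrow> (\<forall>r. fst s' (f r) = fst s r) \<and> (\<forall>b. snd s' (g b) = snd s b) \<and>
     (\<forall>r. r \<notin> range f \<longrightarrow> fst s' r = fst s0 r) \<and> (\<forall>b. b \<notin> range g \<longrightarrow> snd s' b = snd s0 b)"

text \<open>Costs depend on contents and on addresses within a bank, never on the names of registers
  and banks, so the cost \<open>c\<close> is preserved exactly.\<close>

lemma exec_rename:
  assumes "exec P s c t" and "inj f" "inj g" and "renamed_state f g s s0 s'"
  shows "\<exists>t'. exec (rename_com f g P) s' c t' \<and> renamed_state f g t s0 t'"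
  using assms(1,4)
proof (induction arbitrary: s' rule: exec.induct)
  case (Skip s)
  then show ?case unfolding rename_com.simps using exec.Skip by blast
next
  case (Const r n R M)
  obtain R' M' where s': "s' = (R', M')" by (cases s')
  have "renamed_state f g (R(r := n), M) s0 (R'(f r := n), M')"
    using Const assms(2) by (auto simp: renamed_state_def s' inj_eq)
  then show ?case unfolding s' rename_com.simps by (blast intro: exec.Const)
next
  case (Arith h r a b R M)
  obtain R' M' where s': "s' = (R', M')" by (cases s')
  have eq: "R' (f a) = R a" "R' (f b) = R b" using Arith by (auto simp: renamed_state_def s')
  have "renamed_state f g (R(r := arith_val h (R a) (R b)), M) s0 (R'(f r := arith_val h (R' (f a)) (R' (f b))), M')"
    using Arith assms(2) by (auto simp: renamed_state_def s' inj_eq)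
  then show ?case
    unfolding s' rename_com.simps eq[symmetric] using exec.Arith by blast
next
  case (Load r b a R M)
  obtain R' M' where s': "s' = (R', M')" by (cases s')
  have eq: "R' (f a) = R a" "M' (g b) = M b" using Load by (auto simp: renamed_state_def s')
  have "renamed_state f g (R(r := M b (R a)), M) s0 (R'(f r := M' (g b) (R' (f a))), M')"
    using Load assms(2) by (auto simp: renamed_state_def s' inj_eq)
  then show ?case
    unfolding s' rename_com.simps eq[symmetric] using exec.Load by blast
next
  case (Store b a r R M)
  obtain R' M' where s': "s' = (R', M')" by (cases s')
  have eq: "R' (f a) = R a" "R' (f r) = R r" "M' (g b) = M b" using Store by (auto simp: renamed_state_def s')
  have "renamed_state f g (R, M(b := (M b)(R a := R r))) s0 (R', M'(g b := (M' (g b))(R' (f a) := R' (f r))))"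
    using Store assms(3) by (auto simp: renamed_state_def s' inj_eq)
  then show ?case
    unfolding s' rename_com.simps eq[symmetric] using exec.Store by blast
next
  case (Seq P s c t Q d u)
  then show ?case by (metis exec.Seq rename_com.simps(6))
next
  case (IfTrue s r P c t Q)
  then have "fst s' (f r) = fst s r" by (simp add: renamed_state_def)
  then show ?case using IfTrue exec.IfTrue[of s' "f r"] by (metis rename_com.simps(7))
next
  case (IfFalse s r Q c t P)
  then have "fst s' (f r) = fst s r" by (simp add: renamed_state_def)
  then show ?case using IfFalse exec.IfFalse[of s' "f r"] by (metis rename_com.simps(7))
next
  case (WhileTrue s r P c t d u)
  then have "fst s' (f r) = fst s r" by (simp add: renamed_state_def)
  then show ?case using WhileTrue exec.WhileTrue[of s' "f r"] by (metis rename_com.simps(8))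
next
  case (WhileFalse s r P)
  then have "fst s' (f r) = fst s r" by (simp add: renamed_state_def)
  then show ?case using WhileFalse exec.WhileFalse[of s' "f r"] by (metis rename_com.simps(8))
qed

text \<open>The two runs of \<open>P\<close> use disjoint registers and banks, which are zero when they start, so that
  nothing has to be cleared.\<close>

abbreviation left_copy :: "com \<Rightarrow> com" where
  "left_copy \<equiv> rename_com (\<lambda>r. 2 * r + 20) (\<lambda>b. 2 * b + 1)"

abbreviation right_copy :: "com \<Rightarrow> com" where
  "right_copy \<equiv> rename_com (\<lambda>r. 2 * r + 21) (\<lambda>b. 2 * b + 2)"

text \<open>Subtraction is truncated, so the sum of the two differences is the distance of the two
  counts.\<close>

definition compare_outputs :: com where
  "compare_outputs = Seq (Arith Sub 1 20 21) (Seq (Arith Sub 2 21 20) (Seq (Arith Add 1 1 2)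
     (If 1 (Const 0 1) Skip)))"

text \<open>Cell 1 of the input holds the number of edges. A graph without edges is answered by
  register 0, which is still 0.\<close>

definition triangle_program :: "venn \<Rightarrow> com \<Rightarrow> com" where
  "triangle_program V P = Seq (Seq (Const 8 1) (Load 3 0 8)) (If 3
     (Seq (Seq (build V False 1) (build V True 2)) (Seq (Seq (left_copy P) (right_copy P)) compare_outputs)) Skip)"

lemma bits_power: "bits (2 ^ k) = Suc k"
  by (simp add: bits_def)

text \<open>The six operands and the tested register have at most \<open>Suc k\<close> bits each,
  and the last instruction costs 1. The sum \<open>x + y\<close> stays below the bound since one
  summand is 0.\<close>

lemma compare_outputs_correct:
  assumes "R 0 = 0" "R 20 \<le> 2 ^ k" "R 21 \<le> 2 ^ k"
  shows "\<exists>c t. exec compare_outputs (R, M) c t \<and> c \<le> 7 * Suc k + 1 \<and> fst t 0 = of_bool (R 20 \<noteq> R 21)"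
proof -
  define x where "x = R 20 - R 21"
  define y where "y = R 21 - R 20"
  let ?R = "R(1 := x, 2 := y, 1 := x + y)"
  have le: "R 20 \<le> 2 ^ k" "R 21 \<le> 2 ^ k" "x \<le> 2 ^ k" "y \<le> 2 ^ k" "x + y \<le> 2 ^ k"
    using assms by (auto simp: x_def y_def)
  note bits = le[THEN bits_mono, unfolded bits_power]
  have e1: "exec (Arith Sub 1 20 21) (R, M) (bits (R 20) + bits (R 21)) (R(1 := x), M)"
    using exec.Arith[of Sub 1 20 21 R M] by (simp add: x_def)
  have e2: "exec (Arith Sub 2 21 20) (R(1 := x), M) (bits (R 21) + bits (R 20)) (R(1 := x, 2 := y), M)"
    using exec.Arith[of Sub 2 21 20 "R(1 := x)" M] by (simp add: y_def)
  have e3: "exec (Arith Add 1 1 2) (R(1 := x, 2 := y), M) (bits x + bits y) (?R, M)"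
    using exec.Arith[of Add 1 1 2 "R(1 := x, 2 := y)" M] by simp
  have eq: "x + y = 0 \<longleftrightarrow> R 20 = R 21" by (auto simp: x_def y_def)
  have e4: "\<exists>c t. exec (If 1 (Const 0 1) Skip) (?R, M) c t \<and> c \<le> Suc k + 1 \<and> fst t 0 = of_bool (R 20 \<noteq> R 21)"
  proof (cases "x + y = 0")
    case True
    then have "exec (If 1 (Const 0 1) Skip) (?R, M) (bits (fst (?R, M) 1) + 1) (?R, M)"
      by (intro exec.IfFalse exec.Skip) simp
    then show ?thesis using bits(5) True eq assms(1) by (intro exI conjI) (assumption, simp_all)
  next
    case False
    then have "exec (If 1 (Const 0 1) Skip) (?R, M) (bits (fst (?R, M) 1) + bits 1) (?R(0 := 1), M)"
      by (intro exec.IfTrue exec.Const) simp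
    moreover have "R 20 \<noteq> R 21" using False eq by blast
    ultimately show ?thesis using bits(5) bits_power[of 0] by (intro exI conjI) (assumption, simp_all)
  qed
  then obtain c t where t: "exec (If 1 (Const 0 1) Skip) (?R, M) c t" "c \<le> Suc k + 1"
    "fst t 0 = of_bool (R 20 \<noteq> R 21)" by blast
  have "exec compare_outputs (R, M) (bits (R 20) + bits (R 21) + (bits (R 21) + bits (R 20) + (bits x + bits y + c))) t"
    unfolding compare_outputs_def by (intro exec.Seq) (rule e1 e2 e3 t)+
  then show ?thesis using t(2,3) bits by (intro exI conjI) (assumption, simp_all)
qed

lemma triangle_program_empty: "\<exists>c. outputs (triangle_program V P) [0, 0] 0 c \<and> c \<le> 10"
proof -
  let ?R = "(\<lambda>_. 0)(8 := 1, 3 := 0) :: nat \<Rightarrow> nat" and ?M = "snd (initial [0, 0])"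
  have e1: "exec (Const 8 1) (initial [0, 0]) (bits 1) ((\<lambda>_. 0)(8 := 1), ?M)"
    unfolding initial_def snd_conv by (rule exec.Const)
  have "?M 0 1 = 0" by (simp add: initial_def)
  then have e2: "exec (Load 3 0 8) ((\<lambda>_. 0)(8 := 1), ?M) (bits 1 + bits 0) (?R, ?M)"
    using exec.Load[of 3 0 8 "(\<lambda>_. 0)(8 := 1)" ?M] by simp
  have e3: "exec (If 3 Q Skip) (?R, ?M) (bits (fst (?R, ?M) 3) + 1) (?R, ?M)" for Q
    by (intro exec.IfFalse exec.Skip) simp
  have "bits 0 = 1" "bits 1 = 1" by (simp_all add: bits_def)
  moreover have "exec (triangle_program V P) (initial [0, 0])
      (bits 1 + (bits 1 + bits 0) + (bits (fst (?R, ?M) 3) + 1)) (?R, ?M)"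
    unfolding triangle_program_def by (intro exec.Seq) (rule e1 e2 e3)+
  ultimately show ?thesis
    unfolding outputs_def by (intro exI conjI) (assumption, simp_all)
qed

section \<open>Correctness and cost of the reduction\<close>

context graph_encoding
begin

text \<open>Edges have two vertices and no vertex is isolated. This allows time to be measured in
  the number of edges alone, as the Triangle Hypothesis does.\<close>

lemma order_le: "n \<le> 2 * length es"
proof -
  have "n = card (\<Union>e\<in>set es. set e)"
  proof -
    have "(\<Union>e\<in>set es. set e) = \<Union>(edges G)" unfolding es(3)[symmetric] by simp
    also have "\<dots> = {..<n}" using G(1,2) unfolding hypergraph_def by auto
    finally show ?thesis by simp
  qed
  also have "\<dots> \<le> (\<Sum>e\<in>set es. card (set e))" by (rule card_UN_le) simp
  also have "\<dots> = (\<Sum>e\<in>set es. 2)" using es_pairs by (intro sum.cong refl) (simp add: distinct_card)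
  also have "\<dots> \<le> 2 * length es" using card_length[of es] by simp
  finally show ?thesis .
qed

lemma es_wf: "\<forall>e\<in>set es. length e = 2 \<and> set e \<subseteq> {..<n}"
proof
  fix e assume e: "e \<in> set es"
  then have "set e \<in> edges G" unfolding es(3)[symmetric] by simp
  then show "length e = 2 \<and> set e \<subseteq> {..<n}" using G(1,2) es_pairs e unfolding hypergraph_def by blast
qed

text \<open>The two calls of \<open>build\<close> account for \<open>420 * m + 60\<close> units, and
  10 more cover the start and the test. The term \<open>84 * m + 8 = 7 * (12 * m + 1) + 1\<close>
  pays for comparing the counts.\<close>

lemma triangle_program_correct:
  assumes "\<not> degenerate V"
    and out: "\<And>\<sigma>. outputs P (cover_encoding V \<sigma> n es) (card (motifs V (cover_hypergraph V \<sigma> n es))) (c \<sigma>)"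
  defines "m \<equiv> length es"
  shows "\<exists>d. outputs (triangle_program V P) (n # length es # flatten es) (of_bool (has_triangle G)) d \<and>
    d \<le> (420 * m + 70) * (2 * bits (100 * (m + 1))) + c False + c True + 84 * m + 8"
proof -
  let ?xs = "n # length es # flatten es" and ?Z = "100 * (m + 1)"
  define x where "x \<sigma> = card (motifs V (cover_hypergraph V \<sigma> n es))" for \<sigma>
  have x: "x \<sigma> \<le> 2 ^ (12 * m)" for \<sigma> unfolding x_def m_def by (rule card_motifs_le)
  define M0 where "M0 = snd (initial ?xs)"
  have M0: "M0 0 = cells ?xs" "\<And>b. b \<noteq> 0 \<Longrightarrow> M0 b = cells []"
    by (auto simp: M0_def initial_def cells_def)
  have init: "initial ?xs = (\<lambda>_. 0, M0)" by (simp add: initial_def M0_def)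
  have m: "0 < m" using nonempty by (simp add: m_def)
  define R0 :: "nat \<Rightarrow> nat" where "R0 = (\<lambda>_. 0)(8 := 1, 3 := m)"
  have "M0 0 1 = m" using M0(1) by (simp add: cells_def m_def)
  then have "runs ?Z (Seq (Const 8 1) (Load 3 0 8)) (initial ?xs) (1 + 1) (\<lambda>t. t = (R0, M0))"
    unfolding init by (intro runs_Seq runs_Const runs_Load) (simp_all add: R0_def)
  then obtain c0 where c0: "exec (Seq (Const 8 1) (Load 3 0 8)) (initial ?xs) c0 (R0, M0)"
    "c0 \<le> 2 * (2 * bits ?Z)" unfolding runs_def by auto
  have build: "runs ?Z (build V \<sigma> b) s (210 * m + 30)
    (\<lambda>t. snd t = (snd s)(b := cells (cover_encoding V \<sigma> n es)) \<and> (\<forall>r. r = 0 \<or> 10 < r \<longrightarrow> fst t r = fst s r))"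
    if "snd s 0 = cells ?xs" "snd s b = cells []" "b \<noteq> 0" for s b \<sigma>
    unfolding m_def by (rule runs_build[OF that es_wf _ order_le]) simp
  let ?Q = "\<lambda>t. snd t = M0(1 := cells (cover_encoding V False n es), 2 := cells (cover_encoding V True n es)) \<and>
    (\<forall>r. r = 0 \<or> 10 < r \<longrightarrow> fst t r = 0)"
  have "runs ?Z (Seq (build V False 1) (build V True 2)) (R0, M0) ((210 * m + 30) + (210 * m + 30)) ?Q"
    by (rule runs_Seq, rule runs_mono[OF build order_refl],
        (use M0 in \<open>simp_all\<close>)[3], rule runs_mono[OF build order_refl])
      (use M0 in \<open>auto simp: R0_def\<close>)
  then obtain c1 t1 where t1: "exec (Seq (build V False 1) (build V True 2)) (R0, M0) c1 t1"
    "c1 \<le> ((210 * m + 30) + (210 * m + 30)) * (2 * bits ?Z)" "?Q t1" unfolding runs_def by blast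
  obtain a0 where a0: "exec P (initial (cover_encoding V False n es)) (c False) a0" "fst a0 0 = x False"
    using out[of False] unfolding outputs_def x_def by blast
  obtain a1 where a1: "exec P (initial (cover_encoding V True n es)) (c True) a1" "fst a1 0 = x True"
    using out[of True] unfolding outputs_def x_def by blast
  have initial_bank: "snd (initial ys) b = (if b = 0 then cells ys else cells [])" for ys b
    by (auto simp: initial_def cells_def)
  \<comment> \<open>\<open>build\<close> leaves registers above 10 unchanged, so those from 20 on
    are still 0. Bank 1, which holds the first cover, is bank 0 of the left copy.\<close>
  have ren0: "renamed_state (\<lambda>r. 2 * r + 20) (\<lambda>b. 2 * b + 1) (initial (cover_encoding V False n es)) t1 t1"
    using t1(3) M0(2) by (auto simp: renamed_state_def initial_bank) (simp add: initial_def)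
  obtain t2 where t2: "exec (left_copy P) t1 (c False) t2"
    "renamed_state (\<lambda>r. 2 * r + 20) (\<lambda>b. 2 * b + 1) a0 t1 t2"
    using exec_rename[OF a0(1) _ _ ren0] by (auto simp: inj_def)
  have out2: "r \<notin> range (\<lambda>r. 2 * r + 20) \<Longrightarrow> fst t2 r = fst t1 r" "b \<notin> range (\<lambda>b. 2 * b + 1) \<Longrightarrow> snd t2 b = snd t1 b" for r b
    using t2(2) by (simp_all add: renamed_state_def)
  \<comment> \<open>The left copy changes only even registers and odd banks, so the second cover in
    bank 2 and the odd registers are as \<open>build\<close> left them.\<close>
  have ren1: "renamed_state (\<lambda>r. 2 * r + 21) (\<lambda>b. 2 * b + 2) (initial (cover_encoding V True n es)) t2 t2"
  proof -
    have "fst t2 (2 * r + 21) = 0" for r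
      using t1(3) by (subst out2) (auto simp: image_iff, presburger)
    moreover have "snd t2 (2 * b + 2) = (if b = 0 then cells (cover_encoding V True n es) else cells [])" for b
      using t1(3) M0(2) by (subst out2) (auto simp: image_iff, presburger)
    ultimately show ?thesis by (simp add: renamed_state_def initial_bank) (simp add: initial_def)
  qed
  obtain t3 where t3: "exec (right_copy P) t2 (c True) t3"
    "renamed_state (\<lambda>r. 2 * r + 21) (\<lambda>b. 2 * b + 2) a1 t2 t3"
    using exec_rename[OF a1(1) _ _ ren1] by (auto simp: inj_def)
  obtain R3 M3 where t3': "t3 = (R3, M3)" by (cases t3)
  have out3: "r \<notin> range (\<lambda>r. 2 * r + 21) \<Longrightarrow> R3 r = fst t2 r" for r
    using t3(2) by (simp add: renamed_state_def t3')
  have "(0 :: nat) \<notin> range (\<lambda>r. 2 * r + 21)" "(0 :: nat) \<notin> range (\<lambda>r. 2 * r + 20)" by auto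
  then have "R3 0 = 0" using t1(3) out3[of 0] out2(1)[of 0] by simp
  moreover have "R3 20 = x False"
  proof -
    have "(20 :: nat) \<notin> range (\<lambda>r. 2 * r + 21)" by (auto simp: image_iff)
    moreover have "fst t2 (2 * 0 + 20) = fst a0 0" using t2(2) unfolding renamed_state_def by blast
    ultimately show ?thesis using out3[of 20] a0(2) by simp
  qed
  moreover have "R3 21 = x True"
  proof -
    have "fst t3 (2 * 0 + 21) = fst a1 0" using t3(2) unfolding renamed_state_def by blast
    then show ?thesis using a1(2) by (simp add: t3')
  qed
  ultimately obtain c4 t4 where t4: "exec compare_outputs t3 c4 t4" "c4 \<le> 7 * Suc (12 * m) + 1"
    "fst t4 0 = of_bool (x False \<noteq> x True)"
    using compare_outputs_correct[of R3 "12 * m" M3] x unfolding t3' by metis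
  have res: "of_bool (x False \<noteq> x True) = (of_bool (has_triangle G) :: nat)"
    using motif_counts_differ[OF assms(1)] unfolding x_def by simp
  have nonzero: "fst (R0, M0) 3 \<noteq> 0" using m by (simp add: R0_def)
  have "exec (triangle_program V P) (initial ?xs)
      (c0 + (bits (fst (R0, M0) 3) + (c1 + ((c False + c True) + c4)))) t4"
    unfolding triangle_program_def by (intro exec.Seq[OF c0(1)] exec.IfTrue[OF nonzero] exec.Seq[OF t1(1)]
        exec.Seq[OF exec.Seq[OF t2(1) t3(1)]] t4(1))
  then have out_eq: "outputs (triangle_program V P) ?xs (of_bool (has_triangle G))
      (c0 + (bits (fst (R0, M0) 3) + (c1 + ((c False + c True) + c4))))"
    unfolding outputs_def using t4(3) res by (intro exI[of _ t4]) simp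
  have le: "bits (fst (R0, M0) 3) \<le> bits ?Z" by (rule bits_mono) (simp add: R0_def)
  have "c0 + (bits (fst (R0, M0) 3) + (c1 + (c False + c True + c4))) \<le>
      (420 * m + 70) * (2 * bits ?Z) + c False + c True + 84 * m + 8"
  proof -
    have total: "c0 + (b + (c1 + (f + g + c4))) \<le> (k + 10) * (2 * B) + f + g + 84 * m + 8"
      if "c0 \<le> 2 * (2 * B)" "b \<le> B" "c1 \<le> k * (2 * B)" for b B f g k
      using that t4(2) by (simp add: add_mult_distrib)
    have "(210 * m + 30 + (210 * m + 30)) + 10 = 420 * m + 70" by simp
    from total[OF c0(2) le t1(2), unfolded this] show ?thesis .
  qed
  with out_eq show ?thesis by (intro exI conjI)
qed

text \<open>Two header words and at most \<open>12 * 5\<close> words per graph edge, each a number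
  bounded by \<open>100 * (length es + 1)\<close>.\<close>

lemma cover_hypergraph_size_le:
  "hypergraph_size (cover_hypergraph V \<sigma> n es) \<le> (2 + 60 * length es) * bits (100 * (length es + 1))"
proof -
  let ?xs = "cover_encoding V \<sigma> n es" and ?Z = "100 * (length es + 1)"
  have "private_classes V \<le> 3" by (simp add: private_classes_def)
  then have "4 * private_classes V * length es \<le> 12 * length es" by simp
  moreover have "of_bool (V {1, 2, 3}) \<le> (1 :: nat)" by simp
  ultimately have "6 * n + of_bool (V {1, 2, 3}) + 4 * private_classes V * length es \<le>
      6 * (2 * length es) + 1 + 12 * length es"
    using order_le by (intro add_mono mult_le_mono2)
  then have N: "cover_order V n (length es) \<le> ?Z" unfolding cover_order_def by simp
  have "x \<le> ?Z" if "x \<in> set ?xs" for x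
  proof -
    from that consider "x = cover_order V n (length es)" | "x = 12 * length es"
      | e where "e \<in> set (cover_lists V \<sigma> n es)" "x = length e \<or> x \<in> set e"
      by (auto simp: cover_encoding_def)
    then show ?thesis
    proof cases
      case 3
      have "set e \<in> edges (cover_hypergraph V \<sigma> n es)" using 3(1) by (simp add: cover_hypergraph_def)
      then have "set e \<subseteq> {..<cover_order V n (length es)}"
        using cover_hypergraph_instance[of V \<sigma>] unfolding instances_def hypergraph_def
        by (auto simp: cover_hypergraph_def)
      moreover have "length e \<le> 4" using cover_lists_wf[OF 3(1)] by simp
      ultimately show ?thesis using 3(2) N by auto
    qed (use N in auto)
  qed
  then have "sum_list (map bits ?xs) \<le> sum_list (map (\<lambda>_. bits ?Z) ?xs)"
    by (intro sum_list_mono bits_mono)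
  also have "\<dots> = length ?xs * bits ?Z" by (simp add: sum_list_triv)
  also have "length ?xs \<le> 2 + 60 * length es"
    using length_flatten_edge_lists[of V \<sigma> n "label_list es"]
    by (simp add: cover_encoding_def cover_lists_def length_label_list)
  finally show ?thesis
    unfolding hypergraph_size_encoding[OF cover_encoding_encodes] by simp
qed

end

section \<open>Running time\<close>

definition size_bound :: "nat \<Rightarrow> nat" where
  "size_bound m = (2 + 60 * m) * bits (100 * (m + 1))"

text \<open>The cost outside the two runs of \<open>P\<close>. The final 10 also bounds the run on a
  graph without edges.\<close>

definition overhead :: "nat \<Rightarrow> nat" where
  "overhead m = (420 * m + 70) * (2 * bits (100 * (m + 1))) + 84 * m + 10"

text \<open>The size of a cover is known only up to an upper bound, and the given time bound need
  not be monotone; the monotone majorant \<open>U\<close> mediates. It has to dominate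
  \<open>T\<close> at rank at most 4 only, since the covers stay within that rank.\<close>

lemma solves_triangle:
  fixes U :: "nat \<Rightarrow> real"
  assumes nondeg: "\<not> degenerate V" and P: "solves_within P instances (\<lambda>G. card (motifs V G)) T"
    and T: "\<And>G. G \<in> instances \<Longrightarrow> hypergraph_rank G \<le> 4 \<Longrightarrow> T G \<le> U (hypergraph_size G)"
    and U: "mono U" "\<And>y. 0 \<le> U y"
  shows "solves_within (triangle_program V P) {G \<in> instances. uniform 2 G} (\<lambda>G. of_bool (has_triangle G))
    (\<lambda>G. 2 * U (size_bound (card (edges G))) + real (overhead (card (edges G))))"
  unfolding solves_within_def
proof (intro ballI allI impI)
  fix G xs assume "G \<in> {G \<in> instances. uniform 2 G}" and "encodes xs G"
  then have G: "hypergraph G" "verts G = {..<card (verts G)}" "uniform 2 G"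
    by (auto simp: instances_def)
  obtain es where es: "distinct (map set es)" "\<forall>e\<in>set es. distinct e" "set (map set es) = edges G"
    and xs: "xs = card (verts G) # length es # flatten es"
    using \<open>encodes xs G\<close> unfolding encodes_def by blast
  have m: "card (edges G) = length es"
    using distinct_card[OF es(1)] unfolding es(3) by simp
  show "\<exists>c. outputs (triangle_program V P) xs (of_bool (has_triangle G)) c \<and>
      real c \<le> 2 * U (size_bound (card (edges G))) + real (overhead (card (edges G)))"
  proof (cases "es = []")
    case True
    then have "edges G = {}" using es(3) by simp
    then have "card (verts G) = 0" and "\<not> has_triangle G"
      using G(1) unfolding hypergraph_def has_triangle_def by auto
    moreover obtain c where "outputs (triangle_program V P) [0, 0] 0 c" "c \<le> 10"
      using triangle_program_empty by blast
    moreover have "real c \<le> real (overhead (card (edges G)))"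
      using \<open>c \<le> 10\<close> unfolding of_nat_le_iff overhead_def by simp
    ultimately show ?thesis
      using True xs U(2)[of "size_bound (card (edges G))"]
      by (intro exI[of _ c]) simp
  next
    case False
    interpret graph_encoding G "card (verts G)" es
      by unfold_locales (use G es False in auto)
    let ?n = "card (verts G)"
    have "\<exists>c. outputs P (cover_encoding V \<sigma> ?n es) (card (motifs V (cover_hypergraph V \<sigma> ?n es))) c \<and>
        real c \<le> U (size_bound (length es))" for \<sigma>
    proof -
      obtain c where c: "outputs P (cover_encoding V \<sigma> ?n es) (card (motifs V (cover_hypergraph V \<sigma> ?n es))) c"
        "real c \<le> T (cover_hypergraph V \<sigma> ?n es)"
        using P cover_hypergraph_instance cover_encoding_encodes unfolding solves_within_def by blast
      have "T (cover_hypergraph V \<sigma> ?n es) \<le> U (hypergraph_size (cover_hypergraph V \<sigma> ?n es))"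
        by (intro T cover_hypergraph_instance cover_hypergraph_rank)
      also have "\<dots> \<le> U (size_bound (length es))"
        by (rule monoD[OF U(1)]) (simp only: size_bound_def cover_hypergraph_size_le)
      finally show ?thesis using c by fastforce
    qed
    then obtain c where c: "\<And>\<sigma>. outputs P (cover_encoding V \<sigma> ?n es) (card (motifs V (cover_hypergraph V \<sigma> ?n es))) (c \<sigma>)"
      "\<And>\<sigma>. real (c \<sigma>) \<le> U (size_bound (length es))"
      by metis
    obtain d where d: "outputs (triangle_program V P) xs (of_bool (has_triangle G)) d"
      "d \<le> (420 * length es + 70) * (2 * bits (100 * (length es + 1))) + c False + c True + 84 * length es + 8"
      using triangle_program_correct[OF nondeg c(1)] unfolding xs by blast
    have "d \<le> overhead (length es) + c False + c True"
      using d(2) unfolding overhead_def by linarith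
    then have "real d \<le> real (overhead (length es)) + real (c False) + real (c True)"
      by (metis of_nat_add of_nat_mono)
    with d(1) c(2)[of False] c(2)[of True] show ?thesis unfolding m by (intro exI[of _ d]) simp
  qed
qed

lemma ln_ge_1: "3 \<le> m \<Longrightarrow> 1 \<le> ln (real m)"
  using exp_le ln_mono[of "exp 1" "real m"] by simp

text \<open>The argument is at most \<open>m ^ 6\<close>. With \<open>1 / 2 \<le> ln 2\<close> its
  binary logarithm is at most \<open>12 * ln m\<close>, to which \<open>bits\<close> adds 1; the
  factor 20 is generous.\<close>

lemma bits_le:
  assumes "3 \<le> m"
  shows "real (bits (100 * (m + 1))) \<le> 20 * ln (real m)"
proof -
  have "100 * (m + 1) \<le> 3 ^ 5 * m" using assms by simp
  also have "\<dots> \<le> m ^ 5 * m" using assms by (intro mult_le_mono power_mono) auto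
  also have "\<dots> = m ^ 6" by (simp flip: power_Suc2)
  finally have le: "100 * (m + 1) \<le> m ^ 6" .
  let ?k = "floor_log (100 * (m + 1))"
  have "2 ^ ?k \<le> 100 * (m + 1)" by (rule floor_log_exp2_le) simp
  then have "(2 :: real) ^ ?k \<le> real m ^ 6"
    using order.trans[OF _ le, of "2 ^ ?k"] of_nat_mono[of "2 ^ ?k" "m ^ 6", where ?'a = real] by simp
  then have "ln ((2 :: real) ^ ?k) \<le> ln (real m ^ 6)"
    using assms by (intro ln_mono) auto
  then have k: "real ?k * ln 2 \<le> 6 * ln (real m)" using assms by (simp add: ln_realpow)
  \<comment> \<open>From \<open>1 \<le> ln 4\<close> and \<open>4 = 2 ^ 2\<close>.\<close>
  have "1 / 2 \<le> ln (2 :: real)" using ln_ge_1[of 4] ln_realpow[of 2 2] by simp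
  then have "real ?k * (1 / 2) \<le> real ?k * ln 2" by (intro mult_left_mono) auto
  then have "real ?k \<le> 12 * ln (real m)" using k by linarith
  then show ?thesis using ln_ge_1[OF assms] by (simp add: bits_def)
qed

lemma size_bound_le:
  assumes "3 \<le> m"
  shows "real (size_bound m) \<le> 1300 * (real m * ln (real m))" and "ln (real (size_bound m)) \<le> 9 * ln (real m)"
proof -
  have "real (size_bound m) = (2 + 60 * real m) * real (bits (100 * (m + 1)))"
    by (simp add: size_bound_def algebra_simps)
  also have "\<dots> \<le> (65 * real m) * (20 * ln (real m))"
    using assms by (intro mult_mono bits_le) auto
  finally show le: "real (size_bound m) \<le> 1300 * (real m * ln (real m))" by simp
  have "ln (real m) \<le> real m" using ln_le_minus_one[of "real m"] assms by simp
  \<comment> \<open>\<open>3 ^ 7 = 2187\<close> exceeds 1300, and \<open>3 \<le> m\<close> turns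
    this constant into a power of \<open>m\<close>.\<close>
  then have "1300 * (real m * ln (real m)) \<le> 3 ^ 7 * (real m * real m)"
    using ln_ge_1[OF assms] by (intro mult_mono) auto
  also have "\<dots> \<le> real m ^ 7 * (real m * real m)"
    using assms by (intro mult_right_mono power_mono) auto
  also have "\<dots> = real m ^ 9" by (simp flip: power_Suc2 mult.assoc)
  finally have "real (size_bound m) \<le> real m ^ 9" using le by linarith
  moreover have "0 < size_bound m" using bits_pos[of "100 * (m + 1)"] by (simp add: size_bound_def)
  ultimately have "ln (real (size_bound m)) \<le> ln (real m ^ 9)" by (intro ln_mono) auto
  then show "ln (real (size_bound m)) \<le> 9 * ln (real m)" using assms by (simp add: ln_realpow)
qed

lemma overhead_le:
  assumes "3 \<le> m"
  shows "real (overhead m) \<le> 20000 * (real m * ln (real m))"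
proof -
  have "real (overhead m) = (420 * real m + 70) * (2 * real (bits (100 * (m + 1)))) + (84 * real m + 10)"
    by (simp add: overhead_def)
  also have "\<dots> \<le> (445 * real m) * (2 * (20 * ln (real m))) + (90 * real m) * ln (real m)"
  proof (intro add_mono mult_mono)
    have "84 * real m + 10 \<le> (90 * real m) * 1" using assms by simp
    also have "\<dots> \<le> (90 * real m) * ln (real m)"
      using ln_ge_1[OF assms] by (intro mult_left_mono) auto
    finally show "84 * real m + 10 \<le> 90 * real m * ln (real m)" .
  qed (use assms bits_le[OF assms] in auto)
  also have "\<dots> = 17890 * (real m * ln (real m))" by simp
  also have "\<dots> \<le> 20000 * (real m * ln (real m))"
    using ln_ge_1[OF assms] assms by (intro mult_right_mono) auto
  finally show ?thesis .
qed

text \<open>A Landau bound holds only eventually. The finitely many exceptions are absorbed by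
  \<open>A\<close>, the sum of their absolute values.\<close>

lemma soft_O_bound:
  assumes "t \<in> soft_O real"
  shows "\<exists>A B d. 0 \<le> A \<and> 0 \<le> B \<and> (\<forall>y. \<bar>t y\<bar> \<le> A + B * (real y * ln (real y) ^ d))"
proof -
  obtain d where "t \<in> O(\<lambda>n. real n * ln (real n) ^ d)" using assms unfolding soft_O_def by blast
  then obtain B where B: "B > 0" "\<forall>\<^sub>F n in sequentially. norm (t n) \<le> B * norm (real n * ln (real n) ^ d)"
    by (rule landau_o.bigE)
  then obtain n0 where n0: "\<And>n. n0 \<le> n \<Longrightarrow> norm (t n) \<le> B * norm (real n * ln (real n) ^ d)"
    by (auto simp: eventually_at_top_linorder)
  define A where "A = (\<Sum>n<n0. \<bar>t n\<bar>)"
  have nonneg: "0 \<le> real y * ln (real y) ^ d" for y by (cases "y = 0") auto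
  have "\<bar>t y\<bar> \<le> A + B * (real y * ln (real y) ^ d)" for y
  proof (cases "y < n0")
    case True
    then have "\<bar>t y\<bar> \<le> A" unfolding A_def by (intro member_le_sum) auto
    then show ?thesis using B(1) nonneg[of y] by (simp add: add_increasing2)
  next
    case False
    then have "\<bar>t y\<bar> \<le> B * (real y * ln (real y) ^ d)" using n0[of y] nonneg[of y] by simp
    moreover have "0 \<le> A" unfolding A_def by (intro sum_nonneg) simp
    ultimately show ?thesis by simp
  qed
  moreover have "0 \<le> A" unfolding A_def by (intro sum_nonneg) simp
  ultimately show ?thesis using B(1) by (meson less_imp_le)
qed

text \<open>The covers have size of order \<open>m * ln m\<close>, and the logarithm of this is at
  most \<open>9 * ln m\<close>. Substituting it thus costs one more logarithmic factor, hence
  \<open>Suc d\<close>, and constants such as \<open>9 ^ d\<close>. The factor 2 stands for the two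
  runs.\<close>

lemma triangle_time_soft_O:
  assumes "0 \<le> A" "0 \<le> B"
  shows "(\<lambda>m. 2 * (A + B * (real (size_bound m) * ln (real (size_bound m)) ^ d)) + real (overhead m)) \<in> soft_O real"
proof -
  define C where "C = 2 * (A + B * (1300 * 9 ^ d)) + 20000"
  have "norm (2 * (A + B * (real (size_bound m) * ln (real (size_bound m)) ^ d)) + real (overhead m)) \<le>
      C * norm (real m * ln (real m) ^ Suc d)" if m: "3 \<le> m" for m
  proof -
    define L where "L = ln (real m)"
    have L: "1 \<le> L" unfolding L_def by (rule ln_ge_1[OF m])
    define X where "X = real m * L ^ Suc d"
    have pow: "1 \<le> L ^ d" using L by simp
    have "real m * L * 1 \<le> real m * L * L ^ d" using L pow by (intro mult_left_mono) auto
    then have mL: "real m * L \<le> X" by (simp add: X_def mult_ac)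
    have "1 * 1 \<le> real m * L" using m L by (intro mult_mono) auto
    then have X1: "1 \<le> X" using mL by simp
    have S0: "0 \<le> ln (real (size_bound m))" by (cases "size_bound m = 0") auto
    have "real (size_bound m) * ln (real (size_bound m)) ^ d \<le> (1300 * (real m * L)) * (9 * L) ^ d"
      using size_bound_le[OF m] S0 L unfolding L_def by (intro mult_mono power_mono) auto
    also have "\<dots> = (1300 * 9 ^ d) * X" by (simp add: X_def power_mult_distrib mult_ac)
    finally have "B * (real (size_bound m) * ln (real (size_bound m)) ^ d) \<le> B * ((1300 * 9 ^ d) * X)"
      using assms(2) by (rule mult_left_mono)
    moreover have "A \<le> A * X" using assms(1) X1 by (simp add: mult_le_cancel_left1)
    moreover have "real (overhead m) \<le> 20000 * X"
      using overhead_le[OF m] mL unfolding L_def by simp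
    ultimately have "2 * (A + B * (real (size_bound m) * ln (real (size_bound m)) ^ d)) + real (overhead m) \<le> C * X"
      unfolding C_def by (simp add: algebra_simps)
    moreover have "0 \<le> 2 * (A + B * (real (size_bound m) * ln (real (size_bound m)) ^ d)) + real (overhead m)"
      using assms S0 by simp
    ultimately show ?thesis using X1 unfolding X_def L_def by simp
  qed
  then have "\<forall>\<^sub>F m in at_top. norm (2 * (A + B * (real (size_bound m) * ln (real (size_bound m)) ^ d)) + real (overhead m)) \<le>
      C * norm (real m * ln (real m) ^ Suc d)"
    by (rule eventually_mono[OF eventually_ge_at_top])
  moreover have "0 < C" using assms unfolding C_def by (intro add_nonneg_pos) auto
  ultimately have "(\<lambda>m. 2 * (A + B * (real (size_bound m) * ln (real (size_bound m)) ^ d)) + real (overhead m)) \<in>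
      O(\<lambda>m. real m * ln (real m) ^ Suc d)"
    by (intro landau_o.bigI)
  then show ?thesis unfolding soft_O_def by blast
qed

lemma triangle_hypothesis_fails:
  assumes "\<not> degenerate V" and "fpt_near_linear_time V"
  shows "\<not> triangle_hypothesis"
proof -
  obtain f t P where t: "t \<in> soft_O real" and P: "solves_within P instances (\<lambda>G. card (motifs V G))
      (\<lambda>G. real (f (hypergraph_rank G)) * t (hypergraph_size G))"
    using assms(2) unfolding fpt_near_linear_time_def by blast
  obtain A B d where AB: "0 \<le> A" "0 \<le> B" "\<And>y. \<bar>t y\<bar> \<le> A + B * (real y * ln (real y) ^ d)"
    using soft_O_bound[OF t] by blast
  \<comment> \<open>On ranks up to 4 the parameter dependence is bounded by a constant.\<close>
  define F where "F = real (Max (f ` {..4}))"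
  have F: "0 \<le> F" "r \<le> 4 \<Longrightarrow> real (f r) \<le> F" for r by (simp_all add: F_def)
  define U where "U y = F * A + F * B * (real y * ln (real y) ^ d)" for y :: nat
  \<comment> \<open>At \<open>y = 0\<close> this rests on the convention
    \<open>ln 0 = 0\<close>.\<close>
  have ln0: "0 \<le> ln (real y)" for y :: nat by (cases "y = 0") auto
  have "mono U"
  proof (rule monoI)
    fix x y :: nat assume "x \<le> y"
    then have "ln (real x) \<le> ln (real y)" by (cases "x = 0") (use ln0 in auto)
    then show "U x \<le> U y"
      unfolding U_def using \<open>x \<le> y\<close> F(1) AB ln0
      by (intro add_left_mono mult_left_mono mult_mono power_mono) auto
  qed
  moreover have "0 \<le> U y" for y unfolding U_def using F(1) AB ln0 by auto
  moreover have "real (f (hypergraph_rank G)) * t (hypergraph_size G) \<le> U (hypergraph_size G)"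
    if "hypergraph_rank G \<le> 4" for G
  proof -
    \<comment> \<open>A function in \<open>soft_O\<close> may take negative values, so it is
      replaced by its absolute value before \<open>f\<close> is enlarged to
      \<open>F\<close>.\<close>
    have "real (f (hypergraph_rank G)) * t (hypergraph_size G) \<le> real (f (hypergraph_rank G)) * \<bar>t (hypergraph_size G)\<bar>"
      by (intro mult_left_mono) auto
    also have "\<dots> \<le> F * (A + B * (real (hypergraph_size G) * ln (real (hypergraph_size G)) ^ d))"
      using F(1) F(2)[OF that] AB(3) by (intro mult_mono) auto
    finally show ?thesis by (simp add: U_def algebra_simps)
  qed
  ultimately have "solves_within (triangle_program V P) {G \<in> instances. uniform 2 G}
      (\<lambda>G. of_bool (has_triangle G)) (\<lambda>G. 2 * U (size_bound (card (edges G))) + real (overhead (card (edges G))))"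
    by (intro solves_triangle[OF assms(1) P])
  moreover have "(\<lambda>m. 2 * U (size_bound m) + real (overhead m)) \<in> soft_O real"
    unfolding U_def by (rule triangle_time_soft_O) (use F(1) AB in auto)
  ultimately show ?thesis
    unfolding triangle_hypothesis_def not_not
    by (intro bexI[of _ "\<lambda>m. 2 * U (size_bound m) + real (overhead m)"] exI)
qed

lemma near_linear_imp_fpt:
  assumes "near_linear_time V"
  shows "fpt_near_linear_time V"
proof -
  have "exec (Const 0 1) (initial [n]) (bits 1) ((fst (initial [n]))(0 := 1), snd (initial [n]))" for n
    using exec.Const[of 0 1 "fst (initial [n])" "snd (initial [n])"] by simp
  then have "outputs (Const 0 1) [n] 1 (bits 1)" for n
    unfolding outputs_def by (intro exI conjI) (assumption, simp)
  then have "computable (\<lambda>_. 1)" unfolding computable_def by blast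
  moreover obtain t P where "t \<in> soft_O real"
    "solves_within P instances (\<lambda>G. card (motifs V G)) (\<lambda>G. real 1 * t (hypergraph_size G))"
    using assms unfolding near_linear_time_def by auto
  ultimately show ?thesis unfolding fpt_near_linear_time_def by blast
qed

theorem theorem1p3:
  fixes V :: venn
  assumes "connected_venn V"
    and "\<not> degenerate V"
  shows "(fpt_near_linear_time V \<longrightarrow> \<not> triangle_hypothesis \<or> \<not> hyperclique_hypothesis) \<and>
         (near_linear_time V \<longrightarrow> \<not> triangle_hypothesis \<or> \<not> hyperclique_hypothesis)"
  using triangle_hypothesis_fails[OF assms(2)] near_linear_imp_fpt by blast

end
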